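(* Let $m\ge1$ and let $C$ be a binary self-orthogonal linear code of even length $N$ containing the all-ones vector $\mathbf 1$, of dimension $N/2-r$. Then $$\frac{1}{|\mathcal{C}_m|}\sum_{g\in\mathcal{C}_m}g\cdot\mathrm{cwe}(C(m))=\prod_{1\le i\le r}(2^m+2^i)^{-1}\sum_{C'}\mathrm{cwe}(C'(m)),$$ where the sum on the right runs over all binary self-dual codes $C'$ of length $N$ containing $C$.
   Context: Let $\sigma_1=\begin{pmatrix}0&1\\1&0\end{pmatrix}$, $\sigma_2=\begin{pmatrix}1&0\\0&-1\end{pmatrix}$, $E(1)=\langle\sigma_1,\sigma_2\rangle$, and $E(m)\le O(2^m,\mathbb{R})$ the group of all $A_1\otimes\cdots\otimes A_m$ with $A_i\in E(1)$; the real Clifford group $\mathcal{C}_m$ is the normalizer of $E(m)$ in $O(2^m,\mathbb{R})$ (a finite group). Index the standard basis of $\mathbb{R}^{2^m}=(\mathbb{R}^2)^{\otimes m}$ by $v\in\mathbb{F}_2^{\,m}$ via $b_{(v_1,\dots,v_m)}=y_{v_1}\otimes\cdots\otimes y_{v_m}$. Fix an $\mathbb{F}_2$-basis $a_1,\dots,a_m$ of $\mathbb{F}_{2^m}$ and identify $f=\sum\varepsilon_ia_i$ with $(\varepsilon_1,\dots,\varepsilon_m)\in\mathbb{F}_2^{\,m}$, so variables $x_f$ correspond to basis vectors $b_v$; $g\in GL(2^m,\mathbb{R})$ acts on polynomials by $(g\cdot p)(x)=p(g^{-1}x)$. For a binary linear code $C\subseteq\mathbb{F}_2^N$, $C(m)=C\otimes_{\mathbb{F}_2}\mathbb{F}_{2^m}$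 and $\mathrm{cwe}(C(m))=\sum_{c\in C(m)}\prod_{f\in\mathbb{F}_{2^m}}x_f^{a_f(c)}$, $a_f(c)$ being the number of coordinates of $c$ equal to $f$. Self-orthogonal means $C\subseteq C^\perp$ and self-dual means $C=C^\perp$, for the standard dot product. *)

theory Defs
  imports "HOL-Analysis.Analysis" "HOL-Algebra.Group_Action" "HOL-Algebra.Generated_Groups"
    "HOL-Library.Z2"
begin

instance bit :: finite
proof
  have "(UNIV :: bit set) = {0, 1}"
    using bit_not_zero_iff by blast
  then show "finite (UNIV :: bit set)"
    by (metis finite.emptyI finite.insertI)
qed

section \<open>The real Clifford group\<close>

text \<open>
  The length \<open>m\<close> is the cardinality of the finite type \<^typ>\<open>'m\<close>, the field with two elements is
  \<^typ>\<open>bit\<close>, and the matrices of size \<open>2 ^ m\<close> have rows and columns indexed by \<^typ>\<open>bit ^ 'm\<close>: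
  the vector \<open>b\<^sub>v\<close> of the standard basis is \<open>axis v 1\<close>.
\<close>

definition orthogonal_group :: "(real ^ 'k ^ 'k) monoid" where
  "orthogonal_group = \<lparr>carrier = {A. orthogonal_matrix A}, mult = (**), one = mat 1\<rparr>"

definition sigma1 :: "real ^ bit ^ bit" where
  "sigma1 = (\<chi> i j. if i = j then 0 else 1)"

definition sigma2 :: "real ^ bit ^ bit" where
  "sigma2 = (\<chi> i j. if i = j then (if i = 0 then 1 else - 1) else 0)"

definition E1 :: "(real ^ bit ^ bit) set" where
  "E1 = generate orthogonal_group {sigma1, sigma2}"

text \<open>
  Since \<open>b\<^sub>v\<close> is the tensor product of the \<open>y\<^bsub>v $ i\<^esub>\<close>, the entry of a Kronecker product at
  position \<open>(v, w)\<close> is the product of the entries of its factors at the positions \<open>(v $ i, w $ i)\<close>.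
\<close>

definition kronecker :: "('m::finite \<Rightarrow> real ^ bit ^ bit) \<Rightarrow> real ^ (bit ^ 'm) ^ (bit ^ 'm)" where
  "kronecker A = (\<chi> v w. \<Prod>i\<in>UNIV. A i $ (v $ i) $ (w $ i))"

definition E :: "(real ^ (bit ^ 'm::finite) ^ (bit ^ 'm)) set" where
  "E = {kronecker A | A. \<forall>i. A i \<in> E1}"

definition clifford_group :: "(real ^ (bit ^ 'm::finite) ^ (bit ^ 'm)) set" where
  "clifford_group = normalizer orthogonal_group E"

text \<open>
  A polynomial in the variables \<open>x\<^sub>v\<close> is represented by the function on \<open>real ^ (bit ^ 'm)\<close> which
  it defines; as the field of real numbers is infinite, the function determines the polynomial.
\<close>

definition act ::
  "real ^ 'k ^ 'k \<Rightarrow> (real ^ 'k \<Rightarrow> real) \<Rightarrow> (real ^ 'k \<Rightarrow> real)" where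
  "act g p = (\<lambda>x. p (matrix_inv g *v x))"

section \<open>Binary codes\<close>

definition dual_code :: "(bit ^ 'n::finite) set \<Rightarrow> (bit ^ 'n) set" where
  "dual_code C = {x. \<forall>c\<in>C. (\<Sum>j\<in>UNIV. x $ j * c $ j) = 0}"

definition self_orthogonal :: "(bit ^ 'n::finite) set \<Rightarrow> bool" where
  "self_orthogonal C \<longleftrightarrow> vec.subspace C \<and> C \<subseteq> dual_code C"

definition self_dual :: "(bit ^ 'n::finite) set \<Rightarrow> bool" where
  "self_dual C \<longleftrightarrow> vec.subspace C \<and> C = dual_code C"

section \<open>Extension of scalars and the complete weight enumerator\<close>

text \<open>
  The extension field is a finite field \<^typ>\<open>'f\<close> with \<open>2 ^ m\<close> elements. It has
  characteristic 2, so the following makes it a vector space over \<^typ>\<open>bit\<close>.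
\<close>

definition bit_scale :: "bit \<Rightarrow> 'f::field \<Rightarrow> 'f" where
  "bit_scale b x = of_bit b * x"

definition is_bit_basis :: "('m::finite \<Rightarrow> 'f::field) \<Rightarrow> bool" where
  "is_bit_basis a \<longleftrightarrow> inj a \<and> \<not> module.dependent bit_scale (range a) \<and>
     module.span bit_scale (range a) = UNIV"

definition coords :: "('m::finite \<Rightarrow> 'f::field) \<Rightarrow> 'f \<Rightarrow> bit ^ 'm" where
  "coords a f = (THE v. f = (\<Sum>i\<in>UNIV. bit_scale (v $ i) (a i)))"

text \<open>
  The tensor product of \<open>C\<close> with \<^typ>\<open>'f\<close> over \<^typ>\<open>bit\<close>, as a subspace of \<open>'f ^ 'n\<close>.
\<close>

definition extend_code :: "(bit ^ 'n::finite) set \<Rightarrow> ('f::field ^ 'n) set" where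
  "extend_code C = vec.span ((\<lambda>c. \<chi> j. of_bit (c $ j)) ` C)"

definition cwe ::
  "('m::finite \<Rightarrow> 'f::{field,finite}) \<Rightarrow> ('f ^ 'n::finite) set \<Rightarrow> real ^ (bit ^ 'm) \<Rightarrow> real" where
  "cwe a D = (\<lambda>x. \<Sum>c\<in>D. \<Prod>f\<in>UNIV. (x $ coords a f) ^ card {j. c $ j = f})"

end

theory Submission
  imports Defs
begin

text \<open>
  Identifying a word over the extension field with the matrix of its coordinates, the enumerator
  of \<open>C(m)\<close> becomes the sum of the monomials of all matrices with \<open>m\<close> rows in \<open>C\<close>.

  For self-dual \<open>C\<close> this is invariant: conjugation by a Clifford element \<open>g\<close> permutes the Pauli
  matrices, so the coefficient tensor of the transformed enumerator is still fixed by all Pauli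
  matrices placed along words of \<open>C\<close>, and those tensors form a line. The resulting factor is 1, as is
  seen by pairing with the tensor that matches the coordinates in pairs: it is fixed by every
  orthogonal \<open>g\<close>, and its pairing with the original coefficient tensor is positive.

  In general, if \<open>u $ i = 1\<close> then \<open>(X\<^sub>u + Z\<^sub>i) / sqrt 2\<close> is a Clifford element. Summing its action on
  the enumerator of \<open>C\<close> over all \<open>u \<noteq> 0\<close> and averaging over the group expresses the average for \<open>C\<close>
  through the averages for the codes generated by \<open>C\<close> and one word of its dual code. This gives
  the factor \<open>(2 ^ m + 2 ^ r)\<close> and, by induction on \<open>r\<close>, the theorem.
\<close>

section \<open>Binary codes\<close>

declare add_bit_eq_xor [simp del] mult_bit_eq_and [simp del]

text \<open>The nontrivial real character of the additive group of \<open>bit\<close>.\<close>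

definition bsign :: "bit \<Rightarrow> real" where
  "bsign b = (if b = 0 then 1 else - 1)"

lemma bsign_0 [simp]: "bsign 0 = 1" and bsign_1 [simp]: "bsign 1 = - 1"
  by (simp_all add: bsign_def)

lemma bit_add_self [simp]: "b + b = (0 :: bit)"
  by (cases b) auto

lemma bit_mult_self [simp]: "b * b = (b :: bit)"
  by (cases b) auto

lemma bit_vec_add_self [simp]: "v + v = (0 :: bit ^ 'k)"
  by (simp add: vec_eq_iff)

lemma bit_vec_add_self_left [simp]: "v + (v + w) = (w :: bit ^ 'k)"
  by (simp flip: add.assoc)

lemma bit_vec_add_self_right [simp]: "v + w + w = (v :: bit ^ 'k)"
  by (simp add: add.assoc)

lemma bit_vec_mem_translate: "x \<in> (\<lambda>x. x + b) ` A \<longleftrightarrow> x + b \<in> A" for b :: "bit ^ 'k"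
proof
  assume "x + b \<in> A"
  then show "x \<in> (\<lambda>x. x + b) ` A"
    by (intro image_eqI[of _ _ "x + b"]) auto
qed auto

lemma bsign_add: "bsign (a + b) = bsign a * bsign b"
  by (cases a; cases b) auto

lemma bsign_mult_self [simp]: "bsign a * bsign a = 1"
  by (cases a) auto

lemma bsign_sum: "bsign (sum f A) = (\<Prod>x\<in>A. bsign (f x))"
  by (induction A rule: infinite_finite_induct) (auto simp: bsign_add)

section \<open>Dot products, character sums and sizes of codes\<close>

definition bdot :: "bit ^ 'k::finite \<Rightarrow> bit ^ 'k \<Rightarrow> bit" where
  "bdot x y = (\<Sum>j\<in>UNIV. x $ j * y $ j)"

lemma bdot_commute: "bdot x y = bdot y x"
  by (simp add: bdot_def mult.commute)

lemma bdot_add_left: "bdot (x + y) z = bdot x z + bdot y z"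
  by (simp add: bdot_def distrib_right sum.distrib)

lemma bdot_add_right: "bdot z (x + y) = bdot z x + bdot z y"
  by (simp add: bdot_def distrib_left sum.distrib)

lemma bdot_0 [simp]: "bdot 0 x = 0" "bdot x 0 = 0"
  by (simp_all add: bdot_def)

lemma bdot_axis [simp]: "bdot (axis i 1) x = x $ i" "bdot x (axis i 1) = x $ i"
  by (simp_all add: bdot_def axis_def if_distrib if_distribR cong: if_cong)

lemma bdot_self: "bdot x x = bdot x (\<chi> j. 1)"
  by (simp add: bdot_def)

lemma dual_code_iff: "x \<in> dual_code C \<longleftrightarrow> (\<forall>c\<in>C. bdot x c = 0)"
  by (simp add: dual_code_def bdot_def)

lemma sum_translate:
  fixes c :: "bit ^ 'k"
  assumes "\<And>x. x \<in> A \<Longrightarrow> x + c \<in> A"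
  shows "(\<Sum>x\<in>A. f (x + c)) = sum f A"
  by (rule sum.reindex_bij_witness[where i = "\<lambda>x. x + c" and j = "\<lambda>x. x + c"]) (use assms in auto)

text \<open>Orthogonality of characters: if some \<open>c\<close> in \<open>C\<close> has
  \<open>bdot s c = 1\<close>, translation by \<open>c\<close> permutes \<open>C\<close> and negates
  the sum.\<close>

lemma sum_bsign_bdot:
  assumes "vec.subspace C"
  shows "(\<Sum>c\<in>C. bsign (bdot s c)) = (if s \<in> dual_code C then real (card C) else 0)"
proof (cases "s \<in> dual_code C")
  case True
  then show ?thesis
    by (simp add: dual_code_iff)
next
  case False
  then obtain c where c: "c \<in> C" "bdot s c = 1"
    by (auto simp: dual_code_iff)
  have "(\<Sum>x\<in>C. bsign (bdot s x)) = (\<Sum>x\<in>C. bsign (bdot s (x + c)))"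
    by (rule sum_translate[symmetric]) (use c assms vec.subspace_add in auto)
  also have "\<dots> = - (\<Sum>x\<in>C. bsign (bdot s x))"
    by (simp add: bdot_add_right c bsign_add sum_negf)
  finally show ?thesis
    using False by simp
qed

lemma UNIV_bit: "(UNIV :: bit set) = {0, 1}"
  using bit_not_zero_iff by blast

lemma card_UNIV_bit [simp]: "CARD(bit) = 2"
  using UNIV_bit by (metis card_2_iff zero_neq_one)

text \<open>Double counting: the characters are summed over all pairs of \<open>s\<close> and
  \<open>c\<close> in both orders; summing over \<open>s\<close> first leaves only
  \<open>c = 0\<close>.\<close>

lemma card_dual_code:
  fixes C :: "(bit ^ 'n::finite) set"
  assumes "vec.subspace C"
  shows "card C * card (dual_code C) = 2 ^ CARD('n)"
proof -
  have 1: "c \<in> dual_code UNIV \<longleftrightarrow> c = 0" for c :: "bit ^ 'n"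
    by (metis UNIV_I bdot_0(1) bdot_axis(2) dual_code_iff vec_eq_iff zero_index)
  have "real (card (dual_code C)) * real (card C) = (\<Sum>s\<in>UNIV. \<Sum>c\<in>C. bsign (bdot s c))"
    by (simp add: sum_bsign_bdot assms flip: sum.inter_filter)
  also have "\<dots> = (\<Sum>c\<in>C. \<Sum>s\<in>UNIV. bsign (bdot c s))"
    by (subst sum.swap) (simp add: bdot_commute)
  also have "\<dots> = (\<Sum>c\<in>C. if c = 0 then real CARD(bit ^ 'n) else 0)"
    by (simp add: sum_bsign_bdot 1)
  also have "\<dots> = 2 ^ CARD('n)"
    using vec.subspace_0[OF assms] by (simp add: sum.delta)
  finally have "real (card C * card (dual_code C)) = real (2 ^ CARD('n))"
    by (simp add: mult.commute)
  then show ?thesis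
    by (simp only: of_nat_eq_iff)
qed

text \<open>Each new basis vector \<open>b\<close> doubles the span, which becomes the disjoint
  union of the old span and its translate by \<open>b\<close>.\<close>

lemma card_subspace:
  fixes C :: "(bit ^ 'n::finite) set"
  assumes "vec.subspace C"
  shows "card C = 2 ^ vec.dim C"
proof -
  have *: "card (vec.span B) = 2 ^ card B" if "finite B" "vec.independent B" for B :: "(bit ^ 'n) set"
    using that
  proof (induction B)
    case (insert b B)
    then have b: "b \<notin> vec.span B" and ind: "vec.independent B"
      by (auto simp: vec.independent_insert)
    have ex: "(\<exists>k. P k) \<longleftrightarrow> P 0 \<or> P 1" for P :: "bit \<Rightarrow> bool"
      by (metis bit_not_zero_iff)
    have "vec.span (insert b B) = vec.span B \<union> (\<lambda>x. x + b) ` vec.span B"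
    proof -
      have span_iff: "x \<in> vec.span (insert b B) \<longleftrightarrow> x \<in> vec.span B \<or> x + b \<in> vec.span B" for x
      proof -
        have "x - b = x + b"
          by (simp add: vec_eq_iff)
        then show ?thesis
          unfolding vec.span_insert mem_Collect_eq ex by (simp only: vec.scale_zero_left vec.scale_one diff_zero)
      qed
      show ?thesis
        by (intro Set.set_eqI) (simp only: span_iff Un_iff bit_vec_mem_translate)
    qed
    moreover have "vec.span B \<inter> (\<lambda>x. x + b) ` vec.span B = {}"
    proof (rule equals0I)
      fix x
      assume "x \<in> vec.span B \<inter> (\<lambda>x. x + b) ` vec.span B"
      then have "x \<in> vec.span B" "x + b \<in> vec.span B"
        by (simp_all only: Int_iff bit_vec_mem_translate)
      then have "x + (x + b) \<in> vec.span B"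
        by (rule vec.span_add)
      with b show False
        by simp
    qed
    moreover have "card ((\<lambda>x. x + b) ` vec.span B) = card (vec.span B)"
      by (rule card_image) auto
    ultimately show ?case
      using insert ind by (simp add: card_Un_disjoint)
  qed simp
  obtain B where B: "B \<subseteq> C" "vec.independent B" "C \<subseteq> vec.span B" "card B = vec.dim C"
    using vec.basis_exists by blast
  then have "vec.span B = C"
    by (simp add: assms subset_antisym vec.span_minimal)
  with * B show ?thesis
    by (metis finite)
qed

section \<open>Enlarging a code by one word\<close>

definition adjoin :: "bit ^ 'n::finite \<Rightarrow> (bit ^ 'n) set \<Rightarrow> (bit ^ 'n) set" where
  "adjoin t C = {x. x \<in> C \<or> x + t \<in> C}"

lemma subspace_bit_iff:
  fixes C :: "(bit ^ 'n::finite) set"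
  shows "vec.subspace C \<longleftrightarrow> 0 \<in> C \<and> (\<forall>x\<in>C. \<forall>y\<in>C. x + y \<in> C)"
proof -
  have "c *s x \<in> C" if "0 \<in> C" "x \<in> C" for c :: bit and x
    using that by (cases c) auto
  then show ?thesis
    by (auto simp: vec.subspace_def)
qed

lemma subspace_adjoin:
  assumes "vec.subspace C"
  shows "vec.subspace (adjoin t C)"
proof -
  have eq: "(x + t) + y = (x + y) + t" "x + (y + t) = (x + y) + t" "(x + t) + (y + t) = x + y" for x y
    by (simp_all add: ac_simps)
  show ?thesis
    using assms unfolding subspace_bit_iff adjoin_def mem_Collect_eq
    by safe (metis add_0 eq)+
qed

lemma adjoin_subset_iff:
  assumes "vec.subspace C" "vec.subspace D"
  shows "adjoin t C \<subseteq> D \<longleftrightarrow> C \<subseteq> D \<and> t \<in> D"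
  using assms unfolding subspace_bit_iff adjoin_def
  by (auto 4 3) (metis bit_vec_add_self_right in_mono)

text \<open>Over \<open>bit\<close>, \<open>bdot t t\<close> is the product of \<open>t\<close> with
  the all-ones word. As this word lies in \<open>C\<close>, a word of the dual code is orthogonal to
  itself.\<close>

lemma self_orthogonal_adjoin:
  assumes C: "self_orthogonal C" and one: "(\<chi> j. 1) \<in> C" and t: "t \<in> dual_code C"
  shows "self_orthogonal (adjoin t C)"
proof -
  have tt: "bdot t t = 0"
    using one t by (auto simp: bdot_self dual_code_iff)
  have tc: "bdot t c = 0" "bdot c t = 0" if "c \<in> C" for c
    using that t by (auto simp: dual_code_iff bdot_commute)
  have cc: "bdot c d = 0" if "c \<in> C" "d \<in> C" for c d
    using that C by (auto simp: self_orthogonal_def dual_code_iff)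
  have "bdot x y = 0" if "x \<in> adjoin t C" "y \<in> adjoin t C" for x y
  proof -
    have "\<exists>c\<in>C. x = c \<or> x = c + t" if "x \<in> adjoin t C" for x
      using that by (auto simp: adjoin_def intro: bexI[of _ "x + t"])
    from this[OF that(1)] this[OF that(2)]
    obtain c d where "c \<in> C" "x = c \<or> x = c + t" "d \<in> C" "y = d \<or> y = d + t"
      by blast
    then show ?thesis
      using tt tc cc by (auto simp: bdot_add_left bdot_add_right)
  qed
  then show ?thesis
    using C subspace_adjoin by (auto simp: self_orthogonal_def dual_code_iff)
qed

lemma card_adjoin:
  assumes "vec.subspace C" "t \<notin> C"
  shows "card (adjoin t C) = 2 * card C"
proof -
  have "adjoin t C = C \<union> (\<lambda>x. x + t) ` C"
    by (auto simp: adjoin_def bit_vec_mem_translate)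
  moreover have "C \<inter> (\<lambda>x. x + t) ` C = {}"
    using assms by (auto simp: subspace_bit_iff) (metis bit_vec_add_self_left)
  moreover have "card ((\<lambda>x. x + t) ` C) = card C"
    by (rule card_image) auto
  ultimately show ?thesis
    by (simp add: card_Un_disjoint)
qed

section \<open>Weight polynomials and partial Hadamard transforms\<close>

text \<open>
  A map \<open>M :: 'n \<Rightarrow> bit ^ 'm\<close> is an \<open>m \<times> n\<close> matrix given by its columns.
\<close>

definition row_mats :: "(bit ^ 'n::finite) set \<Rightarrow> ('n \<Rightarrow> bit ^ 'm::finite) set" where
  "row_mats C = {M. \<forall>i. (\<chi> j. M j $ i) \<in> C}"

text \<open>The translation X_u applied at the positions in the support of \<open>s\<close>; in
  terms of rows, \<open>s\<close> is added to each row \<open>i\<close> with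
  \<open>u $ i = 1\<close>.\<close>

definition add_rows :: "bit ^ 'm::finite \<Rightarrow> bit ^ 'n::finite \<Rightarrow> ('n \<Rightarrow> bit ^ 'm) \<Rightarrow> 'n \<Rightarrow> bit ^ 'm" where
  "add_rows u s M = (\<lambda>j. M j + s $ j *s u)"

text \<open>The complete weight enumerator in coordinates, see \<open>cwe_extend_code\<close>: the
  column \<open>M j\<close> stands for the letter at position \<open>j\<close>.\<close>

definition weight_poly :: "(bit ^ 'n::finite) set \<Rightarrow> real ^ (bit ^ 'm::finite) \<Rightarrow> real" where
  "weight_poly C x = (\<Sum>M\<in>row_mats C. \<Prod>j\<in>UNIV. x $ M j)"

lemma add_rows_self [simp]: "add_rows u s (add_rows u s M) = M"
  by (simp add: add_rows_def fun_eq_iff)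

lemma add_rows_add [simp]: "add_rows u (s + c) (add_rows u c M) = add_rows u s M"
  by (simp add: add_rows_def fun_eq_iff vec.scale_left_distrib vec_eq_iff algebra_simps)

lemma row_add_rows: "(\<chi> j. add_rows u s M j $ i) = (\<chi> j. M j $ i) + u $ i *s s"
  by (simp add: add_rows_def vec_eq_iff mult.commute)

lemma add_rows_row_mats:
  assumes "vec.subspace C" "c \<in> C" "M \<in> row_mats C"
  shows "add_rows u c M \<in> row_mats C"
  using assms by (auto simp: row_mats_def row_add_rows intro!: vec.subspace_add vec.subspace_scale)

lemma sum_add_rows:
  assumes "vec.subspace C" "c \<in> C"
  shows "(\<Sum>M\<in>row_mats C. f (add_rows u c M)) = sum f (row_mats C)"
  by (rule sum.reindex_bij_witness[where i = "add_rows u c" and j = "add_rows u c"])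
    (use assms add_rows_row_mats in auto)

text \<open>Each matrix with rows in \<open>adjoin t C\<close> arises exactly once: \<open>u\<close>
  marks its rows outside \<open>C\<close>, and adding \<open>t\<close> to these brings them back
  into \<open>C\<close>.\<close>

lemma sum_add_rows_adjoin:
  fixes f :: "('n::finite \<Rightarrow> bit ^ 'm::finite) \<Rightarrow> real"
  assumes C: "vec.subspace C" and t: "t \<notin> C"
  shows "(\<Sum>u\<in>UNIV. \<Sum>M\<in>row_mats C. f (add_rows u t M)) = sum f (row_mats (adjoin t C))"
proof -
  let ?u = "\<lambda>N. (\<chi> i. if (\<chi> j. N j $ i) \<in> C then 0 else 1) :: bit ^ 'm"
  have add: "x + y \<in> C" if "x \<in> C" "y \<in> C" for x y
    using C that by (simp add: vec.subspace_add)
  have [simp]: "x + t \<notin> C" if "x \<in> C" for x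
    using add[OF that, of "x + t"] t by auto
  have u: "?u (add_rows u t M) = u" if "M \<in> row_mats C" for u M
  proof -
    have "(if (\<chi> j. M j $ i) + u $ i *s t \<in> C then 0 else 1) = u $ i" for i
      using that by (cases "u $ i") (auto simp: row_mats_def)
    then show ?thesis
      by (simp add: vec_eq_iff row_add_rows)
  qed
  have "(\<Sum>u\<in>UNIV. \<Sum>M\<in>row_mats C. f (add_rows u t M)) = (\<Sum>(u, M)\<in>UNIV \<times> row_mats C. f (add_rows u t M))"
    by (simp add: sum.cartesian_product)
  also have "\<dots> = sum f (row_mats (adjoin t C))"
  proof (rule sum.reindex_bij_witness[where j = "\<lambda>(u, M). add_rows u t M" and
        i = "\<lambda>N. (?u N, add_rows (?u N) t N)"], goal_cases)
    case (1 a)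
    then show ?case
      using u by (auto simp del: vec_lambda_beta)
  next
    case (2 a)
    have "(\<chi> j. snd a j $ i) + fst a $ i *s t \<in> adjoin t C" for i
      using 2 by (cases "fst a $ i") (auto simp: adjoin_def row_mats_def)
    then show ?case
      by (auto simp: row_mats_def row_add_rows case_prod_unfold)
  next
    case (3 N)
    then show ?case
      by simp
  next
    case (4 N)
    then show ?case
      by (auto simp: row_mats_def row_add_rows adjoin_def)
  next
    case (5 a)
    then show ?case
      by auto
  qed
  finally show ?thesis .
qed

lemma prod_sum_vec:
  fixes f :: "'n::finite \<Rightarrow> 'b::finite \<Rightarrow> real"
  shows "(\<Prod>j\<in>UNIV. \<Sum>b\<in>UNIV. f j b) = (\<Sum>s\<in>UNIV. \<Prod>j\<in>UNIV. f j (s $ j))"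
proof -
  have "(\<Prod>j\<in>UNIV. \<Sum>b\<in>UNIV. f j b) = (\<Sum>s\<in>UNIV. \<Prod>j\<in>UNIV. f j (s j))"
    by (simp add: prod_sum_PiE)
  also have "\<dots> = (\<Sum>s\<in>UNIV. \<Prod>j\<in>UNIV. f j (s $ j))"
    by (rule sum.reindex_bij_witness[where i = vec_nth and j = vec_lambda]) auto
  finally show ?thesis .
qed

section \<open>The elements (X_u + Z_i) / sqrt 2 acting on weight polynomials\<close>

definition hadamard :: "bit ^ 'm::finite \<Rightarrow> 'm \<Rightarrow> real ^ (bit ^ 'm) ^ (bit ^ 'm)" where
  "hadamard u i = (\<chi> v w. ((if v = w + u then 1 else 0) + (if v = w then bsign (w $ i) else 0)) / sqrt 2)"

text \<open>The two summands are indexed by a bit \<open>b\<close>, with 1 for X_u and 0 for Z_i, so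
  that a product over positions can be expanded by \<open>prod_sum_vec\<close>.\<close>

lemma hadamard_mult_vec:
  "(hadamard u i *v x) $ v = (\<Sum>b\<in>UNIV. bsign ((1 + b) * v $ i) * x $ (v + b *s u)) / sqrt 2"
proof -
  have eq: "v = w + u \<longleftrightarrow> w = v + u" for w
    by auto
  have "(hadamard u i *v x) $ v = (\<Sum>w\<in>UNIV. (if w = v + u then x $ w else 0) / sqrt 2 +
      (if w = v then bsign (w $ i) * x $ w else 0) / sqrt 2)"
    unfolding matrix_vector_mult_def hadamard_def by (auto simp: eq add_divide_distrib distrib_right intro!: sum.cong)
  also have "\<dots> = (x $ (v + u) + bsign (v $ i) * x $ v) / sqrt 2"
    by (simp add: sum.distrib add_divide_distrib flip: sum_divide_distrib)
  finally show ?thesis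
    by (simp add: UNIV_bit)
qed

text \<open>In the expanded product, \<open>s\<close> marks the positions where X_u is chosen.
  Choosing Z_i at the others contributes the sign that pairs the complement \<open>?one + s\<close>
  with row \<open>i\<close>.\<close>

lemma weight_poly_hadamard:
  fixes C :: "(bit ^ 'n::finite) set" and u :: "bit ^ 'm::finite"
  assumes C: "self_orthogonal C" and one: "(\<chi> j. 1) \<in> C" and u: "u $ i = 1"
  shows "weight_poly C (hadamard u i *v x) =
    (\<Sum>s\<in>dual_code C. \<Sum>M\<in>row_mats C. \<Prod>j\<in>UNIV. x $ add_rows u s M j) / sqrt 2 ^ CARD('n)"
proof -
  have sub: "vec.subspace C"
    using C by (simp add: self_orthogonal_def)
  have cc: "bdot c d = 0" if "c \<in> C" "d \<in> C" for c d
    using that C by (auto simp: self_orthogonal_def dual_code_iff)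
  let ?one = "(\<chi> j. 1) :: bit ^ 'n"
  let ?row = "\<lambda>M :: 'n \<Rightarrow> bit ^ 'm. (\<chi> j. M j $ i) :: bit ^ 'n"
  let ?X = "\<lambda>s M. \<Prod>j\<in>UNIV. x $ add_rows u s M j"
  let ?T = "\<lambda>s M. bsign (bdot (?one + s) (?row M)) * ?X s M"
  let ?S = "\<Sum>s\<in>UNIV. \<Sum>M\<in>row_mats C. ?T s M"
  have "weight_poly C (hadamard u i *v x) =
      (\<Sum>M\<in>row_mats C. \<Sum>s\<in>UNIV. \<Prod>j\<in>UNIV. bsign ((1 + s $ j) * M j $ i) * x $ (M j + s $ j *s u)) / sqrt 2 ^ CARD('n)"
    unfolding weight_poly_def hadamard_mult_vec prod_dividef prod_sum_vec
    by (simp add: sum_divide_distrib)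
  also have "(\<Sum>M\<in>row_mats C. \<Sum>s\<in>UNIV. \<Prod>j\<in>UNIV. bsign ((1 + s $ j) * M j $ i) * x $ (M j + s $ j *s u)) = ?S"
    by (subst sum.swap) (simp add: prod.distrib bdot_def bsign_sum add_rows_def)
  finally have 1: "weight_poly C (hadamard u i *v x) = ?S / sqrt 2 ^ CARD('n)" .
  \<comment> \<open>Translating both summation variables by \<open>c\<close> only introduces a character of \<open>s\<close>; summing over
    \<open>c\<close> then removes all \<open>s\<close> outside the dual code.\<close>
  have twist: "?S = (\<Sum>s\<in>UNIV. \<Sum>M\<in>row_mats C. bsign (bdot s c) * ?T s M)" if "c \<in> C" for c
  proof -
    have "?S = (\<Sum>s\<in>UNIV. \<Sum>M\<in>row_mats C. ?T (s + c) M)"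
      by (rule sum_translate[symmetric]) auto
    also have "\<dots> = (\<Sum>s\<in>UNIV. \<Sum>M\<in>row_mats C. ?T (s + c) (add_rows u c M))"
      by (intro sum.cong refl sum_add_rows[symmetric] sub that)
    also have "\<dots> = (\<Sum>s\<in>UNIV. \<Sum>M\<in>row_mats C. bsign (bdot s c) * ?T s M)"
    proof (intro sum.cong refl)
      fix s and M :: "'n \<Rightarrow> bit ^ 'm"
      assume "M \<in> row_mats C"
      then have "bdot c (?row M) = 0" "bdot c c = 0" "bdot ?one c = 0"
        using cc one that by (auto simp: row_mats_def)
      then show "?T (s + c) (add_rows u c M) = bsign (bdot s c) * ?T s M"
        by (simp add: row_add_rows u bdot_add_left bdot_add_right bsign_add)
    qed
    finally show ?thesis .
  qed
  have "real (card C) * ?S = (\<Sum>c\<in>C. ?S)"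
    by simp
  also have "\<dots> = (\<Sum>c\<in>C. \<Sum>s\<in>UNIV. \<Sum>M\<in>row_mats C. bsign (bdot s c) * ?T s M)"
    by (rule sum.cong[OF refl]) (rule twist)
  also have "\<dots> = (\<Sum>s\<in>UNIV. \<Sum>M\<in>row_mats C. (\<Sum>c\<in>C. bsign (bdot s c)) * ?T s M)"
    by (subst sum.swap, rule sum.cong[OF refl], subst sum.swap) (simp add: sum_distrib_right)
  also have "\<dots> = (\<Sum>s\<in>UNIV. if s \<in> dual_code C then real (card C) * (\<Sum>M\<in>row_mats C. ?T s M) else 0)"
    by (rule sum.cong) (simp_all add: sum_bsign_bdot sub sum_distrib_left)
  also have "\<dots> = (\<Sum>s\<in>dual_code C. real (card C) * (\<Sum>M\<in>row_mats C. ?T s M))"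
    by (simp flip: sum.inter_filter)
  \<comment> \<open>Now both \<open>s\<close> and the all-ones word are orthogonal to row
    \<open>i\<close>, so the sign is 1.\<close>
  also have "\<dots> = (\<Sum>s\<in>dual_code C. real (card C) * (\<Sum>M\<in>row_mats C. ?X s M))"
  proof (intro sum.cong refl arg_cong2[where f = "(*)"])
    fix s and M :: "'n \<Rightarrow> bit ^ 'm"
    assume "s \<in> dual_code C" "M \<in> row_mats C"
    then have "bdot s (?row M) = 0" "bdot ?one (?row M) = 0"
      using cc one by (auto simp: row_mats_def dual_code_iff)
    then show "?T s M = ?X s M"
      by (simp add: bdot_add_left)
  qed
  finally have "real (card C) * ?S = real (card C) * (\<Sum>s\<in>dual_code C. \<Sum>M\<in>row_mats C. ?X s M)"
    by (simp add: sum_distrib_left)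
  moreover have "card C \<noteq> 0"
    using one by auto
  ultimately show ?thesis
    using 1 by simp
qed

text \<open>A word \<open>t\<close> of \<open>C\<close> only permutes the matrices, so every
  \<open>u\<close> gives the same value. For \<open>t\<close> outside \<open>C\<close>, all
  \<open>u\<close> together give the polynomial of \<open>adjoin t C\<close>, from which the term
  \<open>u = 0\<close> is removed.\<close>

lemma sum_weight_poly_hadamard:
  fixes C :: "(bit ^ 'n::finite) set" and y :: "real ^ (bit ^ 'm::finite)"
  assumes C: "self_orthogonal C" and one: "(\<chi> j. 1) \<in> C"
    and i: "\<And>u. u \<noteq> 0 \<Longrightarrow> u $ i u = 1"
  shows "(\<Sum>u\<in>UNIV - {0}. weight_poly C (hadamard u (i u) *v y)) * sqrt 2 ^ CARD('n) =
    real (card C) * (2 ^ CARD('m) - 1) * weight_poly C y +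
    (\<Sum>t\<in>dual_code C - C. weight_poly (adjoin t C) y - weight_poly C y)"
proof -
  have sub: "vec.subspace C" and CD: "C \<subseteq> dual_code C"
    using C by (auto simp: self_orthogonal_def)
  let ?f = "\<lambda>M. \<Prod>j\<in>UNIV. y $ M j"
  let ?h = "\<lambda>t u :: bit ^ 'm. \<Sum>M\<in>row_mats C. ?f (add_rows u t M)"
  have h0: "?h t 0 = weight_poly C y" for t
    by (simp add: weight_poly_def add_rows_def)
  have hC: "?h t u = weight_poly C y" if "t \<in> C" for t u
    unfolding weight_poly_def by (rule sum_add_rows[OF sub that, where f = ?f])
  have hD: "(\<Sum>u\<in>UNIV. ?h t u) = weight_poly (adjoin t C) y" if "t \<notin> C" for t
    unfolding weight_poly_def by (rule sum_add_rows_adjoin[OF sub that])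
  have "(\<Sum>u\<in>UNIV - {0}. weight_poly C (hadamard u (i u) *v y)) * sqrt 2 ^ CARD('n) =
      (\<Sum>u\<in>UNIV - {0}. \<Sum>t\<in>dual_code C. ?h t u)"
    unfolding sum_distrib_right by (rule sum.cong) (auto simp: weight_poly_hadamard[OF C one i])
  also have "\<dots> = (\<Sum>t\<in>dual_code C. \<Sum>u\<in>UNIV - {0}. ?h t u)"
    by (rule sum.swap)
  also have "\<dots> = (\<Sum>t\<in>C. \<Sum>u\<in>UNIV - {0}. ?h t u) + (\<Sum>t\<in>dual_code C - C. \<Sum>u\<in>UNIV - {0}. ?h t u)"
    using CD by (simp add: sum.subset_diff)
  also have "(\<Sum>t\<in>C. \<Sum>u\<in>UNIV - {0}. ?h t u) = real (card C) * (2 ^ CARD('m) - 1) * weight_poly C y"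
    by (simp add: hC card_Diff_subset of_nat_diff)
  also have "(\<Sum>t\<in>dual_code C - C. \<Sum>u\<in>UNIV - {0}. ?h t u) =
      (\<Sum>t\<in>dual_code C - C. weight_poly (adjoin t C) y - weight_poly C y)"
    by (rule sum.cong) (auto simp: sum_diff1 h0 simp flip: hD)
  finally show ?thesis .
qed

section \<open>Averaging by induction on the codimension\<close>

lemma sum_reindex_hadamard:
  fixes G :: "(real ^ 'k ^ 'k) set"
  assumes h: "h ** h = mat 1" and G: "\<And>g. g \<in> G \<Longrightarrow> h ** g \<in> G"
  shows "(\<Sum>g\<in>G. p (h *v (g *v x))) = (\<Sum>g\<in>G. p (g *v x))"
  by (rule sum.reindex_bij_witness[where i = "(**) h" and j = "(**) h"])
    (use G in \<open>auto simp: matrix_mul_assoc matrix_vector_mul_assoc h\<close>)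

lemma dual_code_antimono: "C \<subseteq> D \<Longrightarrow> dual_code D \<subseteq> dual_code C"
  by (auto simp: dual_code_def)

lemma card_self_dual:
  fixes C :: "(bit ^ 'n::finite) set"
  assumes "self_dual C" "CARD('n) = 2 * k"
  shows "card C = 2 ^ k"
proof -
  have "card C * card C = 2 ^ k * 2 ^ k"
    using card_dual_code[of C] assms by (simp add: self_dual_def power_add mult_2)
  then show ?thesis
    by (metis power2_eq_square power2_eq_imp_eq le0)
qed

lemma self_dual_if_card:
  fixes C :: "(bit ^ 'n::finite) set"
  assumes C: "self_orthogonal C" and N: "CARD('n) = 2 * k" and "card C = 2 ^ k"
  shows "self_dual C"
proof -
  have "2 ^ k * card (dual_code C) = 2 ^ k * 2 ^ k"
    using card_dual_code[of C] assms by (simp add: self_orthogonal_def power_add mult_2)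
  then have "card (dual_code C) = card C"
    using assms by simp
  then have "C = dual_code C"
    using C by (metis card_subset_eq finite self_orthogonal_def)
  then show ?thesis
    using C by (simp add: self_dual_def self_orthogonal_def)
qed

text \<open>Induction on \<open>r\<close>, which measures how far \<open>C\<close> is from being
  self-dual. What is used of the Clifford group is stated as properties of a set \<open>G\<close>:
  closure under left multiplication by the \<open>hadamard\<close> involutions and invariance for
  self-dual codes.\<close>

lemma average_weight_poly:
  fixes C :: "(bit ^ 'n::finite) set" and G :: "(real ^ (bit ^ 'm::finite) ^ (bit ^ 'm)) set"
  assumes N: "CARD('n) = 2 * k"
    and hadamard_G: "\<And>u i g. u $ i = 1 \<Longrightarrow> g \<in> G \<Longrightarrow> hadamard u i ** g \<in> G"
    and hadamard_sq: "\<And>(u :: bit ^ 'm) i. u $ i = 1 \<Longrightarrow> hadamard u i ** hadamard u i = mat 1"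
    and inv: "\<And>(D :: (bit ^ 'n) set) g x. self_dual D \<Longrightarrow> g \<in> G \<Longrightarrow> weight_poly D (g *v x) = weight_poly D x"
    and "self_orthogonal C" "(\<chi> j. 1) \<in> C" "card C * 2 ^ r = 2 ^ k"
  shows "(\<Sum>g\<in>G. weight_poly C (g *v x)) =
    real (card G) * (\<Prod>i=1..r. inverse (2 ^ CARD('m) + 2 ^ i)) * (\<Sum>D | self_dual D \<and> C \<subseteq> D. weight_poly D x)"
  using assms(5-)
proof (induction r arbitrary: C)
  case 0
  then have C: "self_dual C"
    using self_dual_if_card N by auto
  \<comment> \<open>Duality reverses inclusion, so a self-dual code containing a self-dual one
    equals it.\<close>
  then have "{D. self_dual D \<and> C \<subseteq> D} = {C}"
    using dual_code_antimono by (auto simp: self_dual_def) blast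
  then show ?case
    by (simp add: inv C)
next
  case (Suc r)
  have sub: "vec.subspace C"
    using Suc.prems by (simp add: self_orthogonal_def)
  have "\<exists>i. u $ i = 1" if "u \<noteq> 0" for u :: "bit ^ 'm"
    using that by (metis bit_not_zero_iff vec_eq_iff zero_index)
  then obtain ix where ix: "u $ ix u = 1" if "u \<noteq> 0" for u :: "bit ^ 'm"
    by metis
  let ?F = "\<lambda>C. \<Sum>g\<in>G. weight_poly C (g *v x)"
  let ?q = "2 ^ Suc r :: real"
  let ?Q = "2 ^ CARD('m) :: real"
  let ?c = "real (card C)"
  let ?T = "dual_code C - C"
  let ?P = "\<Prod>i=1..r. inverse (?Q + 2 ^ i)"
  have c0: "?c > 0"
    using Suc.prems by (cases "card C = 0") auto
  have k: "?c * ?q = 2 ^ k"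
    using Suc.prems by (metis of_nat_mult of_nat_numeral of_nat_power)
  have sqrt: "sqrt 2 ^ CARD('n) = 2 ^ k"
    by (simp add: N power_mult)
  have "?c * real (card (dual_code C)) = 2 ^ CARD('n)"
    using card_dual_code[OF sub] by (metis of_nat_mult of_nat_numeral of_nat_power)
  also have "\<dots> = 2 ^ k * 2 ^ k"
    by (simp add: N power_add mult_2)
  also have "\<dots> = ?c * (?c * ?q ^ 2)"
    by (simp only: k[symmetric] power2_eq_square mult_ac)
  finally have "real (card (dual_code C)) = ?c * ?q ^ 2"
    using c0 by auto
  then have cardT: "real (card ?T) = ?c * (?q ^ 2 - 1)"
    using Suc.prems
    by (simp add: self_orthogonal_def card_Diff_subset of_nat_diff card_mono algebra_simps)
  \<comment> \<open>Left multiplication by each of the \<open>?Q - 1\<close> involutions only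
    reorders the sum over \<open>G\<close>.\<close>
  have "(?Q - 1) * ?F C = (\<Sum>u\<in>UNIV - {0}. \<Sum>g\<in>G. weight_poly C (hadamard u (ix u) *v (g *v x)))"
    by (simp add: sum_reindex_hadamard[where p = "weight_poly C"] hadamard_sq hadamard_G ix card_Diff_subset of_nat_diff)
  also have "\<dots> = (\<Sum>g\<in>G. \<Sum>u\<in>UNIV - {0}. weight_poly C (hadamard u (ix u) *v (g *v x)))"
    by (rule sum.swap)
  finally have "(?Q - 1) * ?F C * 2 ^ k =
      (\<Sum>g\<in>G. ?c * (?Q - 1) * weight_poly C (g *v x) +
        (\<Sum>t\<in>?T. weight_poly (adjoin t C) (g *v x) - weight_poly C (g *v x)))"
    using sum_weight_poly_hadamard[OF Suc.prems(1,2), of ix] ix by (simp add: sum_distrib_right sqrt)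
  also have "\<dots> = ?c * (?Q - 1) * ?F C + (\<Sum>t\<in>?T. ?F (adjoin t C)) - real (card ?T) * ?F C"
    by (simp add: sum.distrib sum_subtractf sum_distrib_left sum.swap[of _ G])
  \<comment> \<open>As \<open>2 ^ k = ?c * ?q\<close>, the coefficient of \<open>?F C\<close> is
    \<open>?c\<close> times \<open>(?Q - 1) * (?q - 1) + (?q ^ 2 - 1)\<close>, which factors as
    shown.\<close>
  finally have "?c * ((?q - 1) * (?Q + ?q)) * ?F C = (\<Sum>t\<in>?T. ?F (adjoin t C))"
    unfolding cardT k[symmetric] by (simp add: algebra_simps power2_eq_square)
  also have "\<dots> = (\<Sum>t\<in>?T. real (card G) * ?P * (\<Sum>D | self_dual D \<and> C \<subseteq> D \<and> t \<in> D. weight_poly D x))"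
  proof (rule sum.cong[OF refl])
    fix t
    assume t: "t \<in> ?T"
    have "{D. self_dual D \<and> adjoin t C \<subseteq> D} = {D. self_dual D \<and> C \<subseteq> D \<and> t \<in> D}"
      using adjoin_subset_iff[OF sub] by (auto simp: self_dual_def)
    then show "?F (adjoin t C) = real (card G) * ?P * (\<Sum>D | self_dual D \<and> C \<subseteq> D \<and> t \<in> D. weight_poly D x)"
      using t Suc.prems sub by (subst Suc.IH) (auto simp: self_orthogonal_adjoin card_adjoin, auto simp: adjoin_def)
  qed
  also have "\<dots> = real (card G) * ?P * (\<Sum>t\<in>?T. \<Sum>D | (self_dual D \<and> C \<subseteq> D) \<and> t \<in> D. weight_poly D x)"
    by (simp add: sum_distrib_left conj_assoc)
  \<comment> \<open>After the exchange each self-dual \<open>D\<close> is counted once for every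
    word of \<open>D - C\<close>. The number \<open>?c * (?q - 1)\<close> of these is the same for
    all \<open>D\<close> and is cancelled below.\<close>
  also have "(\<Sum>t\<in>?T. \<Sum>D | (self_dual D \<and> C \<subseteq> D) \<and> t \<in> D. weight_poly D x) =
      (\<Sum>D | self_dual D \<and> C \<subseteq> D. \<Sum>t | t \<in> ?T \<and> t \<in> D. weight_poly D x)"
    using sum.swap_restrict[of ?T "{D. self_dual D \<and> C \<subseteq> D}" "\<lambda>t D. weight_poly D x" "\<lambda>t D. t \<in> D"]
    by (simp add: mem_Collect_eq)
  also have "\<dots> = (\<Sum>D | self_dual D \<and> C \<subseteq> D. ?c * (?q - 1) * weight_poly D x)"
  proof (rule sum.cong[OF refl])
    fix D
    assume "D \<in> {D. self_dual D \<and> C \<subseteq> D}"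
    then have D: "self_dual D" "C \<subseteq> D"
      by auto
    then have "D \<subseteq> dual_code C"
      using dual_code_antimono[of C D] by (simp add: self_dual_def)
    then have "{t. t \<in> ?T \<and> t \<in> D} = D - C"
      by auto
    moreover have "real (card D) = ?c * ?q"
      using card_self_dual[OF D(1) N] k by simp
    then have "real (card (D - C)) = ?c * (?q - 1)"
      using D by (simp add: card_Diff_subset of_nat_diff card_mono algebra_simps)
    ultimately show "(\<Sum>t | t \<in> ?T \<and> t \<in> D. weight_poly D x) = ?c * (?q - 1) * weight_poly D x"
      by simp
  qed
  also have "\<dots> = ?c * (?q - 1) * (\<Sum>D | self_dual D \<and> C \<subseteq> D. weight_poly D x)"
    by (simp only: sum_distrib_left)
  finally have eq: "(?c * (?q - 1)) * ((?Q + ?q) * ?F C) =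
      (?c * (?q - 1)) * (real (card G) * ?P * (\<Sum>D | self_dual D \<and> C \<subseteq> D. weight_poly D x))"
    by (simp only: mult_ac)
  have "?q > 1"
    by (simp add: one_less_power del: power_Suc)
  then have nz: "?c * (?q - 1) \<noteq> 0"
    using c0 by auto
  have "(?Q + ?q) * ?F C = real (card G) * ?P * (\<Sum>D | self_dual D \<and> C \<subseteq> D. weight_poly D x)"
    using mult_left_cancel[OF nz] eq by (rule iffD1)
  moreover have "?Q + ?q \<noteq> 0"
    by (metis add_pos_pos less_irrefl zero_less_numeral zero_less_power)
  ultimately show ?case
    by (simp add: field_simps del: power_Suc)
qed

section \<open>Pauli matrices and the Clifford group\<close>

text \<open>The product X_u Z_w scaled by \<open>s\<close>: first the signs given by
  \<open>w\<close>, then the translation by \<open>u\<close>.\<close>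

definition pauli :: "real \<Rightarrow> bit ^ 'm::finite \<Rightarrow> bit ^ 'm \<Rightarrow> real ^ (bit ^ 'm) ^ (bit ^ 'm)" where
  "pauli s u w = (\<chi> v v'. if v = v' + u then s * bsign (bdot w v') else 0)"

lemma matrix_eqI: "(\<And>v w. A $ v $ w = B $ v $ w) \<Longrightarrow> A = (B :: 'a ^ 'k ^ 'l)"
  by (simp add: vec_eq_iff)

lemma mult_pauli_nth: "(A ** pauli s u w) $ v $ v' = A $ v $ (v' + u) * s * bsign (bdot w v')"
proof -
  have "A $ v $ x * pauli s u w $ x $ v' = (if x = v' + u then A $ v $ x * s * bsign (bdot w v') else 0)" for x
    by (simp add: pauli_def)
  then show ?thesis
    by (simp add: matrix_matrix_mult_def)
qed

lemma pauli_mult_nth: "(pauli s u w ** A) $ v $ v' = s * bsign (bdot w (v + u)) * A $ (v + u) $ v'"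
proof -
  have "pauli s u w $ v $ x * A $ x $ v' = (if x = v + u then s * bsign (bdot w x) * A $ x $ v' else 0)" for x
    by (auto simp: pauli_def)
  then show ?thesis
    by (simp add: matrix_matrix_mult_def)
qed

text \<open>The extra sign comes from moving Z_w past the translation by \<open>u'\<close>.\<close>

lemma pauli_mult_pauli:
  "pauli s u w ** pauli s' u' w' = pauli (s * s' * bsign (bdot w u')) (u + u') (w + w')"
proof -
  have "v = v' + u' + u \<longleftrightarrow> v = v' + (u + u')" for v v'
    by (simp add: ac_simps)
  then show ?thesis
    by (auto simp: vec_eq_iff mult_pauli_nth) (auto simp: pauli_def bdot_add_left bdot_add_right bsign_add ac_simps)
qed

lemma pauli_one: "pauli 1 0 0 = mat 1"
  by (simp add: pauli_def mat_def vec_eq_iff)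

lemma transpose_pauli: "transpose (pauli s u w) = pauli (s * bsign (bdot w u)) u w"
proof -
  have "(if v' = v + u then s * bsign (bdot w v) else 0) =
      (if v = v' + u then s * bsign (bdot w u) * bsign (bdot w v') else 0)" for v v'
    by (cases "v = v' + u") (auto simp: bdot_add_right bsign_add mult.assoc)
  then show ?thesis
    by (simp add: transpose_def pauli_def vec_eq_iff)
qed

lemma scaleR_pauli: "c *\<^sub>R pauli s u w = pauli (c * s) u w"
  by (simp add: pauli_def vec_eq_iff)

abbreviation pm :: "real set" where
  "pm \<equiv> {1, - 1}"

lemma bsign_pm: "bsign b \<in> pm"
  by (cases b) auto

lemma pm_mult: "s \<in> pm \<Longrightarrow> t \<in> pm \<Longrightarrow> s * t \<in> pm"
  by auto

lemma orthogonal_pauli: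
  assumes "s \<in> pm"
  shows "orthogonal_matrix (pauli s u w)"
proof -
  have "s * s = 1"
    using assms by auto
  then show ?thesis
    unfolding orthogonal_matrix transpose_pauli pauli_mult_pauli pauli_one[symmetric]
    by (simp add: mult.commute mult.left_commute)
qed

section \<open>The group \<open>E1\<close> and its Kronecker products\<close>

definition pauli1 :: "real \<Rightarrow> bit \<Rightarrow> bit \<Rightarrow> real ^ bit ^ bit" where
  "pauli1 s a b = (\<chi> i j. if i = j + a then s * bsign (b * j) else 0)"

lemma pauli1_mult: "pauli1 s a b ** pauli1 s' a' b' = pauli1 (s * s' * bsign (b * a')) (a + a') (b + b')"
proof -
  have "(\<Sum>k\<in>UNIV. (if i = k + a then s * bsign (b * k) else 0) * (if k = j + a' then s' * bsign (b' * j) else 0)) =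
      (if i = j + (a + a') then s * s' * bsign (b * a') * bsign ((b + b') * j) else 0)" for i j
    unfolding UNIV_bit by (cases i; cases j; cases a; cases a'; cases b; cases b') simp_all
  then show ?thesis
    by (simp add: vec_eq_iff pauli1_def matrix_matrix_mult_def)
qed

lemma transpose_pauli1: "transpose (pauli1 s a b) = pauli1 (s * bsign (a * b)) a b"
proof -
  have "(if i = j + a then s * bsign (b * j) else 0) = (if j = i + a then s * bsign (a * b) * bsign (b * i) else 0)" for i j
    by (cases i; cases j; cases a; cases b) simp_all
  then show ?thesis
    by (simp add: vec_eq_iff pauli1_def transpose_def)
qed

lemma pauli1_one: "pauli1 1 0 0 = mat 1"
  by (simp add: vec_eq_iff pauli1_def mat_def)

lemma sigma_pauli1: "sigma1 = pauli1 1 1 0" "sigma2 = pauli1 1 0 1"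
proof -
  have "(if i = j then 0 else 1) = (if i = j + 1 then 1 * bsign (0 * j) else 0)"
    "(if i = j then if i = 0 then 1 else - 1 else 0) = (if i = j + 0 then 1 * bsign (1 * j) else 0)" for i j :: bit
    by (cases i; cases j; simp)+
  then show "sigma1 = pauli1 1 1 0" "sigma2 = pauli1 1 0 1"
    by (simp_all add: sigma1_def sigma2_def pauli1_def vec_eq_iff)
qed

lemma orthogonal_pauli1:
  assumes "s \<in> pm"
  shows "orthogonal_matrix (pauli1 s a b)"
proof -
  have "s * s = 1"
    using assms by auto
  then show ?thesis
    unfolding orthogonal_matrix transpose_pauli1 pauli1_mult pauli1_one[symmetric]
    by (simp add: mult.commute mult.left_commute)
qed

lemma orthogonal_group_simps [simp]:
  "carrier orthogonal_group = {A. orthogonal_matrix A}"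
  "A \<otimes>\<^bsub>orthogonal_group\<^esub> B = A ** B"
  "\<one>\<^bsub>orthogonal_group\<^esub> = mat 1"
  by (simp_all add: orthogonal_group_def)

lemma group_orthogonal: "group (orthogonal_group :: (real ^ 'k ^ 'k) monoid)"
proof (rule groupI)
  fix A :: "real ^ 'k ^ 'k"
  assume A: "A \<in> carrier orthogonal_group"
  then show "\<exists>B\<in>carrier orthogonal_group. B \<otimes>\<^bsub>orthogonal_group\<^esub> A = \<one>\<^bsub>orthogonal_group\<^esub>"
    by (intro bexI[of _ "transpose A"]) (auto simp: orthogonal_matrix_def)
qed (auto simp: orthogonal_matrix_mul orthogonal_matrix_id matrix_mul_assoc)

lemma inv_orthogonal_group:
  assumes "orthogonal_matrix A"
  shows "inv\<^bsub>orthogonal_group\<^esub> A = transpose A"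
  using assms by (intro group.inv_equality[OF group_orthogonal]) (auto simp: orthogonal_matrix_def)

lemma E1_eq: "E1 = {pauli1 s a b | s a b. s \<in> pm}"
proof (intro equalityI subsetI)
  fix A
  assume "A \<in> E1"
  then show "A \<in> {pauli1 s a b | s a b. s \<in> pm}"
    unfolding E1_def
  proof (induction A rule: generate.induct)
    case one
    show ?case
      unfolding orthogonal_group_simps pauli1_one[symmetric] by blast
  next
    case (incl h)
    then show ?case
      using sigma_pauli1 by auto
  next
    case (inv h)
    then have "h = pauli1 1 1 0 \<or> h = pauli1 1 0 1"
      using sigma_pauli1 by auto
    then obtain a b where h: "h = pauli1 1 a b" "a * b = 0"
      by auto
    \<comment> \<open>The generators are symmetric, hence their own inverses.\<close>
    have "transpose h = pauli1 1 a b"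
      unfolding h transpose_pauli1 by simp
    then have "inv\<^bsub>orthogonal_group\<^esub> h = pauli1 1 a b"
      by (simp add: inv_orthogonal_group orthogonal_pauli1 h(1))
    then show ?case
      by auto
  next
    case (eng h1 h2)
    then obtain s a b s' a' b' where h: "h1 = pauli1 s a b" "h2 = pauli1 s' a' b'" "s \<in> pm" "s' \<in> pm"
      by blast
    show ?case
      unfolding h(1,2) orthogonal_group_simps pauli1_mult
      using pm_mult[OF pm_mult[OF h(3,4)] bsign_pm] by blast
  qed
next
  fix A
  assume "A \<in> {pauli1 s a b | s a b. s \<in> pm}"
  then obtain s a b where A: "A = pauli1 s a b" and s: "s \<in> pm"
    by blast
  have mult: "X ** Y \<in> E1" if "X \<in> E1" "Y \<in> E1" for X Y
    using generate.eng[of X orthogonal_group _ Y] that by (simp add: E1_def)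
  have 1: "pauli1 1 1 0 \<in> E1" "pauli1 1 0 1 \<in> E1"
    using sigma_pauli1 by (auto simp: E1_def intro: generate.incl)
  \<comment> \<open>The two orders of multiplying the generators give XZ with both signs; squaring
    XZ then yields the scalar -1.\<close>
  have 2: "pauli1 1 0 0 \<in> E1" "pauli1 1 1 1 \<in> E1" "pauli1 (- 1) 1 1 \<in> E1"
    using mult[OF 1(1) 1(1)] mult[OF 1(1) 1(2)] mult[OF 1(2) 1(1)] by (simp_all add: pauli1_mult)
  have 3: "pauli1 (- 1) 0 0 \<in> E1"
    using mult[OF 2(2) 2(2)] by (simp add: pauli1_mult)
  have 4: "pauli1 (- 1) 1 0 \<in> E1" "pauli1 (- 1) 0 1 \<in> E1"
    using mult[OF 3 1(1)] mult[OF 3 1(2)] by (simp_all add: pauli1_mult)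
  show "A \<in> E1"
    using s 1 2 3 4 unfolding A by (cases a; cases b) auto
qed

lemma kronecker_pauli1:
  "kronecker (\<lambda>i. pauli1 (s i) (a i) (b i)) = pauli (\<Prod>i\<in>UNIV. s i) (\<chi> i. a i) (\<chi> i. b i)"
proof -
  have "(\<Prod>i\<in>UNIV. if v $ i = v' $ i + a i then s i * bsign (b i * v' $ i) else 0) =
      (if v = v' + (\<chi> i. a i) then (\<Prod>i\<in>UNIV. s i) * bsign (bdot (\<chi> i. b i) v') else 0)" for v v'
  proof (cases "v = v' + (\<chi> i. a i)")
    case True
    then show ?thesis
      by (simp add: prod.distrib bdot_def bsign_sum)
  next
    case False
    then obtain i where "v $ i \<noteq> v' $ i + a i"
      by (auto simp: vec_eq_iff)
    then show ?thesis
      using False by (auto intro!: prod_zero)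
  qed
  then show ?thesis
    by (simp add: kronecker_def pauli1_def pauli_def vec_eq_iff)
qed

lemma E_eq: "E = {pauli s u w | s u w. s \<in> pm}"
proof (intro equalityI subsetI)
  fix B :: "real ^ (bit ^ 'm) ^ (bit ^ 'm)"
  assume "B \<in> E"
  then obtain A where B: "B = kronecker A" and "\<forall>i. A i \<in> E1"
    by (auto simp: E_def)
  then have "\<forall>i. \<exists>s a b. A i = pauli1 s a b \<and> s \<in> pm"
    unfolding E1_eq by blast
  then obtain s a b where sab: "\<And>i. A i = pauli1 (s i) (a i) (b i)" "\<And>i. s i \<in> pm"
    by metis
  have "prod s X \<in> pm" for X
    using sab(2) pm_mult by (induction X rule: infinite_finite_induct) (simp, simp, metis prod.insert)
  moreover have "B = pauli (prod s UNIV) (\<chi> i. a i) (\<chi> i. b i)"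
    unfolding B kronecker_pauli1[symmetric] using sab(1) by presburger
  ultimately show "B \<in> {pauli s u w | s u w. s \<in> pm}"
    by blast
next
  fix B :: "real ^ (bit ^ 'm) ^ (bit ^ 'm)"
  assume "B \<in> {pauli s u w | s u w. s \<in> pm}"
  then obtain s u w where B: "B = pauli s u w" and s: "s \<in> pm"
    by blast
  \<comment> \<open>The sign \<open>s\<close> is put on a single tensor factor, which exists because
    types are nonempty.\<close>
  obtain i0 :: 'm where True
    by simp
  have "B = kronecker (\<lambda>i. pauli1 (if i = i0 then s else 1) (u $ i) (w $ i))"
    unfolding kronecker_pauli1 B by simp
  moreover have "pauli1 (if i = i0 then s else 1) a b \<in> E1" for i a b
    using s unfolding E1_eq by (cases "i = i0") auto
  ultimately show "B \<in> E"
    by (auto simp: E_def)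
qed

lemma finite_E: "finite (E :: (real ^ (bit ^ 'm::finite) ^ (bit ^ 'm)) set)"
proof -
  have eq: "(E :: (real ^ (bit ^ 'm) ^ (bit ^ 'm)) set) = (\<Union>u. \<Union>w. (\<lambda>s. pauli s u w) ` pm)"
    by (auto simp: E_eq)
  show ?thesis
    unfolding eq by (intro finite_UN_I finite_imageI) auto
qed

lemma orthogonal_E: "A \<in> E \<Longrightarrow> orthogonal_matrix A"
  by (auto simp: E_eq orthogonal_pauli)

lemma pauli_in_E: "s \<in> pm \<Longrightarrow> pauli s u w \<in> E"
  unfolding E_eq by blast

section \<open>The Clifford group and its finiteness\<close>

lemma clifford_group_eq:
  "clifford_group = {g. orthogonal_matrix g \<and> (\<lambda>e. g ** e ** transpose g) ` E = E}"
proof -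
  have "E \<subseteq> {A. orthogonal_matrix A}"
    using orthogonal_E by blast
  moreover have "(g <#\<^bsub>orthogonal_group\<^esub> E) #>\<^bsub>orthogonal_group\<^esub> inv\<^bsub>orthogonal_group\<^esub> g =
      (\<lambda>e. g ** e ** transpose g) ` E" if "orthogonal_matrix g" for g :: "real ^ (bit ^ 'm) ^ (bit ^ 'm)"
    using that by (auto simp: l_coset_def r_coset_def inv_orthogonal_group)
  ultimately show ?thesis
    by (auto simp: clifford_group_def normalizer_def stabilizer_def)
qed

lemma subgroup_clifford: "subgroup clifford_group orthogonal_group"
  unfolding clifford_group_def
  using orthogonal_E by (intro group.normalizer_imp_subgroup group_orthogonal) auto

lemma clifford_orthogonal: "g \<in> clifford_group \<Longrightarrow> orthogonal_matrix g"
  by (simp add: clifford_group_eq)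

lemma clifford_mult: "g \<in> clifford_group \<Longrightarrow> h \<in> clifford_group \<Longrightarrow> g ** h \<in> clifford_group"
  using subgroup.m_closed[OF subgroup_clifford] by simp

lemma clifford_transpose:
  assumes "g \<in> clifford_group"
  shows "transpose g \<in> clifford_group"
  using subgroup.m_inv_closed[OF subgroup_clifford assms] clifford_orthogonal[OF assms]
  by (simp add: inv_orthogonal_group)

lemma clifford_commute:
  assumes "g \<in> clifford_group" "e \<in> E"
  obtains e' where "e' \<in> E" "g ** e = e' ** g"
proof
  show "g ** e ** transpose g \<in> E"
    using assms by (auto simp: clifford_group_eq)
  show "g ** e = g ** e ** transpose g ** g"
    using clifford_orthogonal[OF assms(1)] by (simp add: orthogonal_matrix flip: matrix_mul_assoc)
qed

text \<open>Commuting with the sign matrices Z_i kills the off-diagonal entries, and commuting with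
  the translations makes the diagonal constant.\<close>

lemma centralizer_E:
  fixes k :: "real ^ (bit ^ 'm::finite) ^ (bit ^ 'm)"
  assumes comm: "\<And>e. e \<in> E \<Longrightarrow> k ** e = e ** k"
  shows "k = (k $ 0 $ 0) *\<^sub>R mat 1"
proof -
  have "k ** pauli 1 u w = pauli 1 u w ** k" for u w
    by (rule comm) (simp add: pauli_in_E)
  then have *: "k $ v $ (v' + u) * 1 * bsign (bdot w v') = 1 * bsign (bdot w (v + u)) * k $ (v + u) $ v'"
    for u w v v'
    using mult_pauli_nth[of k 1 u w v v'] pauli_mult_nth[of 1 u w k v v'] by simp
  have entry: "k $ v $ v' = (if v = v' then k $ 0 $ 0 else 0)" for v v'
  proof (cases "v = v'")
    case True
    then show ?thesis
      using *[of v 0 v 0] by simp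
  next
    case False
    then obtain i where "v $ i \<noteq> v' $ i"
      by (metis vec_eq_iff)
    then have "bsign (bdot (axis i 1) v') = - bsign (bdot (axis i 1) v)"
      by (cases "v $ i"; cases "v' $ i") auto
    then have "k $ v $ v' = 0"
      using *[of v v' 0 "axis i 1"] by (cases "v $ i") auto
    then show ?thesis
      using False by simp
  qed
  show ?thesis
    by (rule matrix_eqI, subst entry) (simp add: mat_def)
qed

text \<open>Conjugation sends the group to the finite set of self-maps of \<open>E\<close>, so an
  infinite group would have an infinite fibre; but each fibre is contained in
  \<open>{h, - 1 *\<^sub>R h}\<close>.\<close>

lemma finite_clifford: "finite (clifford_group :: (real ^ (bit ^ 'm::finite) ^ (bit ^ 'm)) set)"
proof (rule ccontr)
  let ?G = "clifford_group :: (real ^ (bit ^ 'm) ^ (bit ^ 'm)) set"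
  let ?F = "\<lambda>g. \<lambda>e\<in>E. g ** e ** transpose g :: real ^ (bit ^ 'm) ^ (bit ^ 'm)"
  assume inf: "infinite ?G"
  have "?F ` ?G \<subseteq> E \<rightarrow>\<^sub>E E"
    by (auto simp: clifford_group_eq)
  then have fin: "finite (?F ` ?G)"
    by (rule finite_subset) (intro finite_PiE finite_E)
  obtain y where y: "y \<in> ?F ` ?G" "infinite (?F -` {y} \<inter> ?G)"
    using inf_img_fin_dom'[OF fin inf] by (rule bexE)
  obtain h where yh: "y = ?F h" and h: "h \<in> ?G"
    using y(1) by (rule imageE)
  have fib: "infinite (?F -` {?F h} \<inter> ?G)"
    using y(2) unfolding yh .
  have "g \<in> {h, - 1 *\<^sub>R h}" if g: "g \<in> ?G" and eq: "?F g = ?F h" for g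
  proof -
    \<comment> \<open>Equal conjugation on \<open>E\<close> makes \<open>?k\<close> commute with
      \<open>E\<close>, hence scalar; orthogonality leaves 1 and -1.\<close>
    let ?k = "transpose h ** g"
    have og: "transpose g ** g = mat 1" "g ** transpose g = mat 1"
      and oh: "transpose h ** h = mat 1" "h ** transpose h = mat 1"
      using clifford_orthogonal g h by (auto simp: orthogonal_matrix_def)
    have "?k ** e = e ** ?k" if "e \<in> E" for e
    proof -
      have "g ** e ** transpose g = h ** e ** transpose h"
        using fun_cong[OF eq, of e] that by simp
      then have "transpose h ** (g ** e ** transpose g) ** g = transpose h ** (h ** e ** transpose h) ** g"
        by simp
      moreover have "transpose h ** (g ** e ** transpose g) ** g = ?k ** e"
        by (simp add: og flip: matrix_mul_assoc)
      moreover have "transpose h ** (h ** e ** transpose h) ** g = e ** ?k"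
        by (simp add: oh matrix_mul_assoc)
      ultimately show ?thesis
        by simp
    qed
    define c where "c = ?k $ 0 $ 0"
    have k: "?k = c *\<^sub>R mat 1"
      unfolding c_def by (rule centralizer_E) fact
    have "transpose ?k ** ?k = mat 1"
      using clifford_orthogonal[OF clifford_mult[OF clifford_transpose[OF h] g]] by (simp only: orthogonal_matrix)
    moreover have "transpose ?k ** ?k = (c * c) *\<^sub>R mat 1"
      unfolding k
      by (simp add: transpose_scalar scalar_matrix_assoc[symmetric] matrix_scalar_ac transpose_mat)
    ultimately have cc: "(c * c) *\<^sub>R mat 1 = (mat 1 :: real ^ (bit ^ 'm) ^ (bit ^ 'm))"
      by simp
    have "c * c = 1"
      using arg_cong[OF cc, of "\<lambda>A. A $ 0 $ 0"] by (simp add: mat_def)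
    then have "c \<in> pm"
      using square_eq_1_iff by auto
    moreover have "g = c *\<^sub>R h"
    proof -
      have "g = h ** ?k"
        by (simp add: oh matrix_mul_assoc)
      also have "\<dots> = c *\<^sub>R h"
        unfolding k by (simp add: matrix_scalar_ac)
      finally show ?thesis .
    qed
    ultimately show ?thesis
      by auto
  qed
  then have "?F -` {?F h} \<inter> ?G \<subseteq> {h, - 1 *\<^sub>R h}"
    by blast
  with fib show False
    using finite_subset by blast
qed

section \<open>Membership of (X_u + Z_i) / sqrt 2 in the Clifford group\<close>

lemma pauli_add: "pauli s u w + pauli t u w = pauli (s + t) u w"
  by (simp add: pauli_def vec_eq_iff distrib_right)

lemma hadamard_pauli: "hadamard u i = (1 / sqrt 2) *\<^sub>R (pauli 1 u 0 + pauli 1 0 (axis i 1))"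
proof -
  have "hadamard u i $ v $ v' = ((1 / sqrt 2) *\<^sub>R (pauli 1 u 0 + pauli 1 0 (axis i 1))) $ v $ v'" for v v'
    by (simp add: hadamard_def pauli_def)
  then show ?thesis
    by (rule matrix_eqI)
qed

lemma matrix_add_mult: "(B + C) ** A = B ** A + C ** (A :: real ^ _ ^ _)"
  by (simp add: vec_eq_iff matrix_matrix_mult_def distrib_right sum.distrib)

lemma hadamard_mult_hadamard:
  "hadamard u i ** A ** hadamard u i = (1 / 2) *\<^sub>R ((pauli 1 u 0 ** A ** pauli 1 u 0 +
    pauli 1 0 (axis i 1) ** A ** pauli 1 0 (axis i 1)) +
    (pauli 1 u 0 ** A ** pauli 1 0 (axis i 1) + pauli 1 0 (axis i 1) ** A ** pauli 1 u 0))"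
  by (simp add: hadamard_pauli matrix_scalar_ac scalar_matrix_assoc[symmetric] matrix_add_ldistrib
      matrix_add_mult algebra_simps)

text \<open>X_u and Z_i anticommute because \<open>u $ i = 1\<close>. If both commute with the given
  Pauli matrix up to the same sign, the mixed terms cancel; otherwise the unmixed terms cancel and
  the mixed ones coincide.\<close>

lemma hadamard_conj_pauli:
  assumes "u $ i = 1"
  shows "hadamard u i ** pauli s a b ** hadamard u i =
    (if bdot b u = a $ i then pauli (s * bsign (a $ i)) a b else pauli s (a + u) (b + axis i 1))"
proof -
  have s0: "pauli 0 a b = 0" for a b :: "bit ^ 'a"
    by (simp add: pauli_def vec_eq_iff)
  have ac: "u + a + u = a" "axis i 1 + b + axis i 1 = b" "u + a = a + u" "axis i 1 + b = b + axis i 1"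
    by (simp_all add: ac_simps)
  show ?thesis
    unfolding hadamard_mult_hadamard pauli_mult_pauli
    by (cases "bdot b u"; cases "a $ i")
      (simp_all add: bdot_add_left bsign_add assms ac pauli_add scaleR_pauli s0)
qed

lemma hadamard_sq: "u $ i = 1 \<Longrightarrow> hadamard u i ** hadamard u i = mat 1"
  using hadamard_conj_pauli[of u i 1 0 0] by (simp add: pauli_one)

lemma transpose_hadamard: "transpose (hadamard u i) = hadamard u i"
  by (auto simp: transpose_def hadamard_def vec_eq_iff)

lemma hadamard_clifford:
  assumes "u $ i = 1"
  shows "hadamard u i \<in> clifford_group"
proof -
  let ?c = "\<lambda>e. hadamard u i ** e ** hadamard u i"
  have 1: "?c e \<in> E" if "e \<in> E" for e
  proof -
    obtain s a b where e: "e = pauli s a b" "s \<in> pm"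
      using \<open>e \<in> E\<close> by (auto simp: E_eq)
    then show ?thesis
      by (cases "a $ i") (auto simp: hadamard_conj_pauli assms intro!: pauli_in_E)
  qed
  have 2: "?c (?c e) = e" for e
    using hadamard_sq[OF assms] by (metis matrix_mul_assoc matrix_mul_lid matrix_mul_rid)
  have "?c ` E = E"
    using 1 2 by (metis (no_types, lifting) image_eqI image_subset_iff subsetI subset_antisym)
  then show ?thesis
    by (simp add: clifford_group_eq orthogonal_matrix transpose_hadamard hadamard_sq assms)
qed

section \<open>Invariance for self-dual codes\<close>

lemma sum_bdot_rows:
  "(\<Sum>j\<in>UNIV. c $ j * bdot z (M j)) = (\<Sum>i\<in>UNIV. z $ i * bdot c (\<chi> j. M j $ i))"
  by (simp add: bdot_def sum_distrib_left mult_ac) (rule sum.swap)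

text \<open>The coefficients before equal monomials are collected, so that Pauli matrices can act at
  single positions.\<close>

definition tensor_coeff :: "(bit ^ 'n::finite) set \<Rightarrow> real ^ (bit ^ 'm::finite) ^ (bit ^ 'm) \<Rightarrow> ('n \<Rightarrow> bit ^ 'm) \<Rightarrow> real" where
  "tensor_coeff C g M = (\<Sum>M'\<in>row_mats C. \<Prod>j\<in>UNIV. g $ M' j $ M j)"

lemma weight_poly_mult_vec: "weight_poly C (g *v x) = (\<Sum>M\<in>UNIV. tensor_coeff C g M * (\<Prod>j\<in>UNIV. x $ M j))"
proof -
  have "weight_poly C (g *v x) = (\<Sum>M'\<in>row_mats C. \<Sum>M\<in>UNIV. (\<Prod>j\<in>UNIV. g $ M' j $ M j) * (\<Prod>j\<in>UNIV. x $ M j))"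
    by (simp add: weight_poly_def matrix_vector_mult_def prod_sum_PiE prod.distrib)
  also have "\<dots> = (\<Sum>M\<in>UNIV. tensor_coeff C g M * (\<Prod>j\<in>UNIV. x $ M j))"
    by (subst sum.swap) (simp add: tensor_coeff_def sum_distrib_right)
  finally show ?thesis .
qed

text \<open>Moving \<open>g\<close> past a Pauli matrix at each position of \<open>c\<close> turns
  it into another Pauli matrix, which permutes the matrices with rows in \<open>C\<close> with total
  sign 1.\<close>

lemma tensor_coeff_add_rows:
  fixes C :: "(bit ^ 'n::finite) set" and g :: "real ^ (bit ^ 'm::finite) ^ (bit ^ 'm)"
  assumes C: "self_orthogonal C" and one: "(\<chi> j. 1) \<in> C" and c: "c \<in> C" and g: "g \<in> clifford_group"
  shows "tensor_coeff C g (add_rows u c M) * bsign (\<Sum>j\<in>UNIV. c $ j * bdot z (M j)) = tensor_coeff C g M"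
proof -
  have sub: "vec.subspace C"
    using C by (simp add: self_orthogonal_def)
  have cc: "bdot c d = 0" if "d \<in> C" for d
    using that C c by (auto simp: self_orthogonal_def dual_code_iff)
  have "pauli 1 u z \<in> E"
    by (simp add: pauli_in_E)
  with g obtain e' where "e' \<in> E" and e': "g ** pauli 1 u z = e' ** g"
    by (rule clifford_commute)
  then obtain s u' z' where s: "s \<in> pm" and "e' = pauli s u' z'"
    unfolding E_eq by blast
  with e' have comm: "g ** pauli 1 u z = pauli s u' z' ** g"
    by simp
  \<comment> \<open>With the sign written as a character value, all signs collect in one exponent
    over \<open>bit\<close>.\<close>
  obtain b where b: "s = bsign b"
    using s bsign_0 bsign_1 by (metis insert_iff singletonD)
  have entry: "g $ v $ (v' + u) * bsign (bdot z v') = bsign (b + bdot z' (v + u')) * g $ (v + u') $ v'" for v v'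
  proof -
    have "(g ** pauli 1 u z) $ v $ v' = (pauli s u' z' ** g) $ v $ v'"
      by (simp only: comm)
    then show ?thesis
      by (simp add: mult_pauli_nth pauli_mult_nth b bsign_add)
  qed
  have "tensor_coeff C g (add_rows u c M) * bsign (\<Sum>j\<in>UNIV. c $ j * bdot z (M j)) =
      (\<Sum>M'\<in>row_mats C. \<Prod>j\<in>UNIV. g $ M' j $ add_rows u c M j * bsign (c $ j * bdot z (M j)))"
    by (simp add: tensor_coeff_def sum_distrib_right prod.distrib bsign_sum)
  also have "\<dots> = (\<Sum>M'\<in>row_mats C. \<Prod>j\<in>UNIV. g $ add_rows u' c M' j $ M j)"
  proof (rule sum.cong[OF refl])
    fix M' :: "'n \<Rightarrow> bit ^ 'm"
    assume "M' \<in> row_mats C"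
    then have rows: "bdot c (\<chi> j. M' j $ i) = 0" for i
      using cc by (simp add: row_mats_def)
    \<comment> \<open>The constant part occurs once per position of \<open>c\<close>, an even
      number; the rest vanishes since \<open>c\<close> is orthogonal to the rows.\<close>
    have "(\<Sum>j\<in>UNIV. c $ j * (b + bdot z' (M' j + u'))) =
        (b + bdot z' u') * bdot c (\<chi> j. 1) + (\<Sum>j\<in>UNIV. c $ j * bdot z' (M' j))"
      by (simp add: bdot_add_right distrib_left distrib_right sum.distrib bdot_def[of c] sum_distrib_left mult_ac add_ac)
    also have "\<dots> = 0"
      by (simp add: cc one sum_bdot_rows rows)
    finally have total: "(\<Prod>j\<in>UNIV. bsign (c $ j * (b + bdot z' (M' j + u')))) = 1"
      by (simp flip: bsign_sum)
    have "g $ M' j $ add_rows u c M j * bsign (c $ j * bdot z (M j)) =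
        bsign (c $ j * (b + bdot z' (M' j + u'))) * g $ add_rows u' c M' j $ M j" for j
      by (cases "c $ j") (auto simp: add_rows_def entry)
    then show "(\<Prod>j\<in>UNIV. g $ M' j $ add_rows u c M j * bsign (c $ j * bdot z (M j))) =
        (\<Prod>j\<in>UNIV. g $ add_rows u' c M' j $ M j)"
      by (simp add: prod.distrib total)
  qed
  also have "\<dots> = tensor_coeff C g M"
    unfolding tensor_coeff_def by (rule sum_add_rows[OF sub c])
  finally show ?thesis .
qed

text \<open>Translations along codewords carry an \<open>M\<close> with rows in \<open>C\<close> to
  0 without changing the coefficient. A row outside \<open>C\<close>, which is its own dual, gives a
  sign change that forces the coefficient to vanish.\<close>

lemma tensor_coeff_self_dual:
  fixes g :: "real ^ (bit ^ 'm::finite) ^ (bit ^ 'm)"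
  assumes C: "self_dual C" and g: "g \<in> clifford_group"
  shows "tensor_coeff C g M = (if M \<in> row_mats C then tensor_coeff C g (\<lambda>_. 0) else 0)"
proof -
  have sub: "vec.subspace C" and CD: "C = dual_code C"
    using C by (simp_all only: self_dual_def)
  have so: "self_orthogonal C"
    unfolding self_orthogonal_def using sub equalityD1[OF CD] by (rule conjI)
  have dual: "x \<in> C \<longleftrightarrow> (\<forall>c\<in>C. bdot x c = 0)" for x
    by (simp only: dual_code_iff[of x C, symmetric] CD[symmetric])
  have "bdot c c = 0" if "c \<in> C" for c
    using dual that by blast
  \<comment> \<open>Words orthogonal to themselves have even weight, so the all-ones word is in the
    dual code.\<close>
  then have one: "(\<chi> j. 1) \<in> C"
    using dual[of "\<chi> j. 1"] by (simp add: bdot_self bdot_commute[of "\<chi> j. 1"])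
  note add_rows = tensor_coeff_add_rows[OF so one _ g]
  show ?thesis
  proof (cases "M \<in> row_mats C")
    case True
    have "tensor_coeff C g M = tensor_coeff C g (\<lambda>_. 0)" if "M \<in> row_mats C" "\<And>i. i \<notin> I \<Longrightarrow> (\<chi> j. M j $ i) = 0" "finite I" for M I
      using that(3,1,2)
    proof (induction I arbitrary: M)
      case empty
      then have "M = (\<lambda>_. 0)"
        by (auto simp: vec_eq_iff)
      then show ?case
        by simp
    next
      case (insert i I)
      define c where "c = (\<chi> j. M j $ i)"
      have c: "c \<in> C"
        using insert.prems by (simp add: c_def row_mats_def)
      \<comment> \<open>Adding row \<open>i\<close> to itself clears it and leaves the other rows
        unchanged.\<close>
      have "tensor_coeff C g M = tensor_coeff C g (add_rows (axis i 1) c M)"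
        using add_rows[OF c, of "axis i 1" M 0] by simp
      also have "\<dots> = tensor_coeff C g (\<lambda>_. 0)"
      proof (rule insert.IH)
        show "add_rows (axis i 1) c M \<in> row_mats C"
          using sub c insert.prems(1) by (rule add_rows_row_mats)
        fix k
        assume "k \<notin> I"
        then show "(\<chi> j. add_rows (axis i 1) c M j $ k) = 0"
          using insert.prems(2)[of k] by (cases "k = i") (simp_all add: row_add_rows c_def axis_def)
      qed
      finally show ?case .
    qed
    from this[of M UNIV] show ?thesis
      using True by simp
  next
    case False
    then obtain i where "(\<chi> j. M j $ i) \<notin> C"
      by (auto simp: row_mats_def)
    then obtain c where "c \<in> C" "bdot (\<chi> j. M j $ i) c \<noteq> 0"
      using dual[of "\<chi> j. M j $ i"] by blast
    then have c: "c \<in> C" "bdot c (\<chi> j. M j $ i) = 1"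
      by (simp_all add: bdot_commute)
    have "(\<Sum>j\<in>UNIV. c $ j * bdot (axis i 1) (M j)) = 1"
      using c(2) by (simp add: bdot_def[of c])
    moreover have "add_rows 0 c M = M"
      by (simp add: add_rows_def)
    ultimately have "- tensor_coeff C g M = tensor_coeff C g M"
      using add_rows[OF c(1), of 0 M "axis i 1"] by simp
    then show ?thesis
      using False by simp
  qed
qed

section \<open>Pairing the coordinates\<close>

lemma even_card_involution:
  assumes "even (card (UNIV :: 'n::finite set))"
  shows "\<exists>S. \<exists>\<tau> :: 'n \<Rightarrow> 'n::finite. (\<forall>j. \<tau> (\<tau> j) = j) \<and> bij_betw \<tau> S (- S)"
proof -
  obtain k where k: "CARD('n) = 2 * k"
    using assms by blast
  then obtain S :: "'n set" where S: "card S = k"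
    using obtain_subset_with_card_n[of k "UNIV :: 'n set"] by auto
  have "card (- S) = k"
    using S k by (simp add: Compl_eq_Diff_UNIV card_Diff_subset)
  then obtain f where f: "bij_betw f S (- S)"
    using S finite_same_card_bij[of S "- S"] by auto
  define \<tau> where "\<tau> j = (if j \<in> S then f j else inv_into S f j)" for j
  have "\<tau> (\<tau> j) = j" for j
  proof (cases "j \<in> S")
    case True
    then have "f j \<notin> S" "inv_into S f (f j) = j"
      using f bij_betwE bij_betw_inv_into_left by fastforce+
    then show ?thesis
      using True by (simp add: \<tau>_def)
  next
    case False
    then have "inv_into S f j \<in> S" "f (inv_into S f j) = j"
      using f bij_betw_inv_into bij_betwE bij_betw_inv_into_right by (metis ComplI)+
    then show ?thesis
      using False by (simp add: \<tau>_def)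
  qed
  moreover have "bij_betw \<tau> S (- S)"
    using f by (rule bij_betw_cong[THEN iffD1, rotated]) (simp add: \<tau>_def)
  ultimately show ?thesis
    by blast
qed

text \<open>The sum factors over the pairs, and each factor is an inner product of two rows of
  \<open>g\<close>, which is 1 or 0 by orthonormality.\<close>

lemma sum_paired_orthogonal:
  fixes \<tau> :: "'n::finite \<Rightarrow> 'n" and g :: "real ^ 'k ^ 'k"
  assumes g: "orthogonal_matrix g" and inv: "\<And>j. \<tau> (\<tau> j) = j" and bij: "bij_betw \<tau> S (- S)"
  shows "(\<Sum>M | \<forall>j. M (\<tau> j) = M j. \<Prod>j\<in>UNIV. g $ M' j $ M j) = (if \<forall>j. M' (\<tau> j) = M' j then 1 else 0)"
proof -
  have \<tau>: "j \<in> S \<longleftrightarrow> \<tau> j \<notin> S" for j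
    using bij inv by (metis ComplD ComplI bij_betwE bij_betw_imp_surj_on imageE)
  have gg: "(\<Sum>v\<in>UNIV. g $ x $ v * g $ y $ v) = (if x = y then 1 else 0)" for x y
  proof -
    have "(g ** transpose g) $ x $ y = mat 1 $ x $ y"
      using g by (simp add: orthogonal_matrix_def)
    then show ?thesis
      by (simp add: matrix_matrix_mult_def transpose_def mat_def)
  qed
  have split: "prod f UNIV = (\<Prod>j\<in>S. f j * f (\<tau> j))" for f :: "'n \<Rightarrow> real"
  proof -
    have "prod f UNIV = prod f S * prod f (- S)"
      by (metis Compl_eq_Diff_UNIV finite mult.commute prod.subset_diff top_greatest)
    also have "prod f (- S) = (\<Prod>j\<in>S. f (\<tau> j))"
      by (rule prod.reindex_bij_betw[OF bij, symmetric])
    finally show ?thesis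
      by (simp add: prod.distrib)
  qed
  have "(\<Sum>M | \<forall>j. M (\<tau> j) = M j. \<Prod>j\<in>UNIV. g $ M' j $ M j) =
      (\<Sum>M | \<forall>j. M (\<tau> j) = M j. \<Prod>j\<in>S. g $ M' j $ M j * g $ M' (\<tau> j) $ M j)"
    by (rule sum.cong) (auto simp: split)
  \<comment> \<open>A paired \<open>M\<close> is determined by its columns in \<open>S\<close>,
    which are free.\<close>
  also have "\<dots> = (\<Sum>N\<in>S \<rightarrow>\<^sub>E UNIV. \<Prod>j\<in>S. g $ M' j $ N j * g $ M' (\<tau> j) $ N j)"
  proof (rule sum.reindex_bij_witness[where j = "\<lambda>M. restrict M S" and
        i = "\<lambda>N j. N (if j \<in> S then j else \<tau> j)"], goal_cases)
    case (1 M)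
    show ?case
    proof
      fix j
      show "restrict M S (if j \<in> S then j else \<tau> j) = M j"
        using 1 \<tau>[of j] by (cases "j \<in> S") auto
    qed
  next
    case (2 M)
    then show ?case
      by auto
  next
    case (3 N)
    then show ?case
      by (auto simp: restrict_def PiE_def extensional_def)
  next
    case (4 N)
    have "N (if \<tau> j \<in> S then \<tau> j else \<tau> (\<tau> j)) = N (if j \<in> S then j else \<tau> j)" for j
      using \<tau>[of j] inv[of j] by (cases "j \<in> S") auto
    then show ?case
      by blast
  next
    case (5 M)
    then show ?case
      by simp
  qed
  also have "\<dots> = (\<Prod>j\<in>S. \<Sum>v\<in>UNIV. g $ M' j $ v * g $ M' (\<tau> j) $ v)"
    by (rule prod_sum_PiE[symmetric]) auto
  also have "\<dots> = (if \<forall>j\<in>S. M' j = M' (\<tau> j) then 1 else 0)"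
    by (auto simp: gg intro: prod_zero)
  also have "(\<forall>j\<in>S. M' j = M' (\<tau> j)) \<longleftrightarrow> (\<forall>j. M' (\<tau> j) = M' j)"
    using \<tau> inv by metis
  finally show ?thesis .
qed

lemma weight_poly_self_dual_invariant:
  fixes C :: "(bit ^ 'n::finite) set" and g :: "real ^ (bit ^ 'm::finite) ^ (bit ^ 'm)"
  assumes even: "even CARD('n)" and C: "self_dual C" and g: "g \<in> clifford_group"
  shows "weight_poly C (g *v x) = weight_poly C x"
proof -
  obtain S and \<tau> :: "'n \<Rightarrow> 'n" where inv: "\<And>j. \<tau> (\<tau> j) = j" and bij: "bij_betw \<tau> S (- S)"
    using even_card_involution[OF even] by metis
  let ?D = "{M :: 'n \<Rightarrow> bit ^ 'm. \<forall>j. M (\<tau> j) = M j}"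
  let ?w = "tensor_coeff C g (\<lambda>_. 0)"
  have restr: "(\<Sum>M\<in>A. if M \<in> B then f M else 0) = sum f (A \<inter> B)"
    for A B :: "('n \<Rightarrow> bit ^ 'm) set" and f :: "_ \<Rightarrow> real"
    by (rule sum.inter_restrict[symmetric]) simp
  \<comment> \<open>The same sum is evaluated twice: it counts the paired matrices with rows in
    \<open>C\<close>, here with weight 1 and below with weight \<open>?w\<close>. The zero matrix is
    among them, so \<open>?w = 1\<close>.\<close>
  have "(\<Sum>M\<in>?D. tensor_coeff C g M) = (\<Sum>M'\<in>row_mats C. if M' \<in> ?D then 1 else 0)"
    unfolding tensor_coeff_def
    by (subst sum.swap) (simp add: sum_paired_orthogonal[OF clifford_orthogonal[OF g] inv bij])
  moreover have "(\<Sum>M\<in>?D. tensor_coeff C g M) = (\<Sum>M\<in>?D. if M \<in> row_mats C then ?w else 0)"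
    by (rule sum.cong[OF refl tensor_coeff_self_dual[OF C g]])
  ultimately have "real (card (?D \<inter> row_mats C)) * ?w = real (card (?D \<inter> row_mats C))"
    unfolding restr by (simp add: Int_commute)
  moreover have "(\<lambda>_. 0) \<in> ?D \<inter> row_mats C"
    using C vec.subspace_0[of C] by (auto simp: row_mats_def self_dual_def zero_vec_def)
  then have "card (?D \<inter> row_mats C) \<noteq> 0"
    by auto
  ultimately have w: "?w = 1"
    by simp
  have "weight_poly C (g *v x) = (\<Sum>M\<in>UNIV. if M \<in> row_mats C then \<Prod>j\<in>UNIV. x $ M j else 0)"
    unfolding weight_poly_mult_vec by (rule sum.cong[OF refl], subst tensor_coeff_self_dual[OF C g]) (simp add: w)
  then show ?thesis
    unfolding restr by (simp add: weight_poly_def)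
qed

section \<open>Complete weight enumerators\<close>

text \<open>Translation by 1 permutes the field, so its cardinality, a power of 2, is zero in
  it.\<close>

lemma two_eq_zero:
  assumes "CARD('f::{field,finite}) = 2 ^ m"
  shows "(2 :: 'f) = 0"
proof -
  have "(\<Sum>x\<in>UNIV. x + 1 :: 'f) = (\<Sum>x\<in>UNIV. x)"
    by (rule sum.reindex_bij_witness[where i = "\<lambda>x. x - 1" and j = "\<lambda>x. x + 1"]) auto
  then have "of_nat CARD('f) = (0 :: 'f)"
    by (simp add: sum.distrib)
  then show ?thesis
    by (simp add: assms)
qed

lemma of_bit_hom:
  assumes "(2 :: 'f::field) = 0"
  shows "of_bit (b + c) = (of_bit b + of_bit c :: 'f)" "of_bit (b * c) = (of_bit b * of_bit c :: 'f)"
proof -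
  have "(1 + 1 :: 'f) = 0"
    using assms by simp
  then show "of_bit (b + c) = (of_bit b + of_bit c :: 'f)" "of_bit (b * c) = (of_bit b * of_bit c :: 'f)"
    by (cases b; cases c; simp)+
qed

text \<open>A word of the extended code is the combination, with coefficients \<open>a i\<close>, of
  the rows of its coordinate matrix, and these rows are words of \<open>C\<close>.\<close>

lemma cwe_extend_code:
  fixes a :: "'m::finite \<Rightarrow> 'f::{field,finite}" and C :: "(bit ^ 'n::finite) set"
  assumes card: "CARD('f) = 2 ^ CARD('m)" and basis: "is_bit_basis a" and C: "vec.subspace C"
  shows "cwe a (extend_code C) x = weight_poly C x"
proof -
  have two: "(2 :: 'f) = 0"
    by (rule two_eq_zero[OF card])
  note hom = of_bit_hom[OF two]
  interpret V: vector_space "bit_scale :: bit \<Rightarrow> 'f \<Rightarrow> 'f"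
    by standard (simp_all only: bit_scale_def hom, simp_all add: algebra_simps)
  \<comment> \<open>The additive inverse map of \<open>coords\<close>; it is onto as
    \<open>a\<close> spans, hence bijective by cardinality.\<close>
  define comb where "comb v = (\<Sum>i\<in>UNIV. of_bit (v $ i) * a i)" for v :: "bit ^ 'm"
  have comb_add: "comb (v + w) = comb v + comb w" for v w
    by (simp only: comb_def hom vector_add_component distrib_right sum.distrib)
  have comb_scale: "comb (b *s v) = of_bit b * comb v" for b v
    by (cases b) (simp_all add: comb_def)
  have comb_0: "comb 0 = 0"
    by (simp add: comb_def)
  have comb_sum: "comb (sum f A) = (\<Sum>i\<in>A. comb (f i))" for f :: "'m \<Rightarrow> bit ^ 'm" and A
    by (induction A rule: infinite_finite_induct) (simp_all add: comb_0 comb_add)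
  have "range comb = UNIV"
  proof -
    have "\<exists>v. f = comb v" for f
    proof -
      have "f \<in> V.span (range a)"
        using basis by (simp add: is_bit_basis_def)
      then obtain u where "f = (\<Sum>y\<in>range a. bit_scale (u y) y)"
        by (auto simp: V.span_finite)
      also have "\<dots> = comb (\<chi> i. u (a i))"
        using basis by (subst sum.reindex) (auto simp: is_bit_basis_def comb_def bit_scale_def)
      finally show ?thesis
        by blast
    qed
    then show ?thesis
      by blast
  qed
  moreover from this have inj: "inj comb"
    by (intro eq_card_imp_inj_on) (simp_all add: card)
  ultimately have bij: "bij comb"
    by (simp add: bij_def)
  have coords_comb [simp]: "coords a (comb v) = v" for v
    unfolding coords_def bit_scale_def comb_def[symmetric] using inj by (auto simp: inj_eq)
  have comb_coords [simp]: "comb (coords a f) = f" for f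
    using bij by (metis bij_pointE coords_comb)
  define emb where "emb M = (\<chi> j. comb (M j))" for M :: "'n \<Rightarrow> bit ^ 'm"
  have ext_eq: "extend_code C = emb ` row_mats C"
  proof (rule equalityI)
    have "vec.subspace (emb ` row_mats C)"
      unfolding vec.subspace_def
    proof (intro conjI ballI allI)
      show "0 \<in> emb ` row_mats C"
      proof (rule image_eqI)
        show "0 = emb (\<lambda>_. 0)"
          by (simp add: emb_def comb_0 vec_eq_iff)
        show "(\<lambda>_. 0) \<in> row_mats C"
          using vec.subspace_0[OF C] by (simp add: row_mats_def zero_vec_def)
      qed
    next
      fix p q
      assume "p \<in> emb ` row_mats C" "q \<in> emb ` row_mats C"
      then obtain M N where MN: "p = emb M" "q = emb N" "M \<in> row_mats C" "N \<in> row_mats C"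
        by blast
      have "(\<chi> j. (M j + N j) $ i) = (\<chi> j. M j $ i) + (\<chi> j. N j $ i)" for i
        by (simp add: vec_eq_iff)
      then have "(\<lambda>j. M j + N j) \<in> row_mats C"
        using MN vec.subspace_add[OF C] by (simp add: row_mats_def)
      then show "p + q \<in> emb ` row_mats C"
        by (rule rev_image_eqI) (simp add: MN emb_def vec_eq_iff comb_add)
    next
      fix c p
      assume "p \<in> emb ` row_mats C"
      then obtain M where M: "p = emb M" "M \<in> row_mats C"
        by blast
      \<comment> \<open>Each \<open>c * a i\<close> is expanded in the basis again, so the rows of
        \<open>?N\<close> are binary combinations of the rows of \<open>M\<close>.\<close>
      let ?N = "\<lambda>j. \<Sum>i\<in>UNIV. M j $ i *s coords a (c * a i)"
      have "(\<chi> j. ?N j $ k) = (\<Sum>i\<in>UNIV. coords a (c * a i) $ k *s (\<chi> j. M j $ i))" for k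
        by (simp add: vec_eq_iff mult.commute)
      then have "?N \<in> row_mats C"
        using M by (auto simp: row_mats_def intro!: vec.subspace_sum[OF C] vec.subspace_scale[OF C])
      moreover have "c * comb v = comb (\<Sum>i\<in>UNIV. v $ i *s coords a (c * a i))" for v
        unfolding comb_sum comb_scale comb_coords comb_def[of v]
        by (simp only: sum_distrib_left mult.left_commute)
      then have "c *s p = emb ?N"
        by (simp add: M emb_def vec_eq_iff)
      ultimately show "c *s p \<in> emb ` row_mats C"
        by blast
    qed
    moreover have "(\<lambda>c. \<chi> j. of_bit (c $ j)) ` C \<subseteq> emb ` row_mats C"
    proof
      fix p :: "'f ^ 'n"
      assume "p \<in> (\<lambda>c. \<chi> j. of_bit (c $ j)) ` C"
      then obtain c where c: "c \<in> C" "p = (\<chi> j. of_bit (c $ j))"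
        by blast
      let ?M = "\<lambda>j. c $ j *s coords a 1"
      have "(\<chi> j. ?M j $ i) = coords a 1 $ i *s c" for i
        by (simp add: vec_eq_iff mult.commute)
      then have "?M \<in> row_mats C"
        using c vec.subspace_scale[OF C] by (simp add: row_mats_def)
      moreover have "p = emb ?M"
        by (simp add: c emb_def vec_eq_iff comb_scale)
      ultimately show "p \<in> emb ` row_mats C"
        by blast
    qed
    ultimately show "extend_code C \<subseteq> emb ` row_mats C"
      unfolding extend_code_def by (intro vec.span_minimal)
  next
    show "emb ` row_mats C \<subseteq> extend_code C"
    proof
      fix p
      assume "p \<in> emb ` row_mats C"
      then obtain M where M: "p = emb M" "M \<in> row_mats C"
        by blast
      have "p = (\<Sum>i\<in>UNIV. a i *s (\<chi> j. of_bit ((\<chi> j. M j $ i) $ j)))"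
        by (simp add: M emb_def vec_eq_iff comb_def mult.commute)
      also have "\<dots> \<in> extend_code C"
        using M unfolding extend_code_def row_mats_def
        by (intro vec.span_sum vec.span_scale vec.span_base) blast
      finally show "p \<in> extend_code C" .
    qed
  qed
  have inj_emb: "inj_on emb (row_mats C)"
  proof (rule inj_onI)
    fix M N
    assume eq: "emb M = emb N"
    have "M j = N j" for j
      using arg_cong[OF eq, of "\<lambda>v. v $ j"] inj by (simp add: emb_def inj_eq)
    then show "M = N"
      by (rule ext)
  qed
  \<comment> \<open>Grouping the positions by letter turns multiplicities into a product over
    positions.\<close>
  have prod_eq: "(\<Prod>f\<in>UNIV. (x $ coords a f) ^ card {j. c $ j = f}) = (\<Prod>j\<in>UNIV. x $ coords a (c $ j))"
    for c :: "'f ^ 'n"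
  proof -
    have "(\<Prod>f\<in>UNIV. (x $ coords a f) ^ card {j. c $ j = f}) =
        (\<Prod>f\<in>UNIV. \<Prod>j | j \<in> UNIV \<and> c $ j = f. x $ coords a (c $ j))"
      by simp
    also have "\<dots> = (\<Prod>j\<in>UNIV. x $ coords a (c $ j))"
      by (rule prod.group) auto
    finally show ?thesis .
  qed
  have "cwe a (extend_code C) x = (\<Sum>M\<in>row_mats C. \<Prod>j\<in>UNIV. x $ coords a (emb M $ j))"
    unfolding cwe_def ext_eq prod_eq sum.reindex[OF inj_emb] o_def ..
  then show ?thesis
    by (simp add: weight_poly_def emb_def)
qed

lemma matrix_inv_orthogonal:
  fixes g :: "real ^ 'k ^ 'k"
  assumes "orthogonal_matrix g"
  shows "matrix_inv g = transpose g"
proof -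
  have "g ** transpose g = mat 1 \<and> transpose g ** g = mat 1"
    using assms by (simp add: orthogonal_matrix_def)
  then have "g ** matrix_inv g = mat 1 \<and> matrix_inv g ** g = mat 1"
    unfolding matrix_inv_def by (rule someI)
  then have "matrix_inv g ** (g ** transpose g) = transpose g"
    by (simp add: matrix_mul_assoc)
  then show ?thesis
    using assms by (simp add: orthogonal_matrix_def)
qed

theorem theorem4p10:
  fixes a :: "'m::finite \<Rightarrow> 'f::{field,finite}"
    and C :: "(bit ^ 'n::finite) set"
    and r :: nat
  assumes "CARD('f) = 2 ^ CARD('m)"
    and "is_bit_basis a"
    and "even CARD('n)"
    and "self_orthogonal C"
    and "(\<chi> j. 1) \<in> C"
    and "real (vec.dim C) = real CARD('n) / 2 - real r"
  shows "(\<lambda>x. 1 / real (card (clifford_group :: (real ^ (bit ^ 'm) ^ (bit ^ 'm)) set)) *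
             (\<Sum>g\<in>clifford_group. act g (cwe a (extend_code C)) x)) =
         (\<lambda>x. (\<Prod>i=1..r. inverse (2 ^ CARD('m) + 2 ^ i)) *
             (\<Sum>C' | self_dual C' \<and> C \<subseteq> C'. cwe a (extend_code C') x))"
proof
  fix x :: "real ^ (bit ^ 'm)"
  let ?G = "clifford_group :: (real ^ (bit ^ 'm) ^ (bit ^ 'm)) set"
  obtain k where k: "CARD('n) = 2 * k"
    using assms(3) by blast
  have sub: "vec.subspace C"
    using assms(4) by (simp add: self_orthogonal_def)
  have "vec.dim C + r = k"
    using assms(6) k by simp
  then have card_C: "card C * 2 ^ r = 2 ^ k"
    using card_subspace[OF sub] by (simp flip: power_add)
  have "(\<Sum>g\<in>?G. act g (cwe a (extend_code C)) x) = (\<Sum>g\<in>?G. weight_poly C (transpose g *v x))"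
    by (rule sum.cong)
      (simp_all add: act_def cwe_extend_code[OF assms(1,2) sub] matrix_inv_orthogonal clifford_orthogonal)
  \<comment> \<open>Inversion, here transposition, permutes the group.\<close>
  also have "\<dots> = (\<Sum>g\<in>?G. weight_poly C (g *v x))"
    by (rule sum.reindex_bij_witness[where i = transpose and j = transpose]) (auto simp: clifford_transpose)
  also have "\<dots> = real (card ?G) * (\<Prod>i=1..r. inverse (2 ^ CARD('m) + 2 ^ i)) *
      (\<Sum>D | self_dual D \<and> C \<subseteq> D. weight_poly D x)"
    by (rule average_weight_poly[OF k])
      (use assms(3-5) card_C in \<open>auto intro: clifford_mult hadamard_clifford hadamard_sq weight_poly_self_dual_invariant\<close>)
  also have "(\<Sum>D | self_dual D \<and> C \<subseteq> D. weight_poly D x) =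
      (\<Sum>D | self_dual D \<and> C \<subseteq> D. cwe a (extend_code D) x)"
    by (rule sum.cong) (auto simp: self_dual_def cwe_extend_code[OF assms(1,2)])
  finally have "(\<Sum>g\<in>?G. act g (cwe a (extend_code C)) x) = real (card ?G) *
      ((\<Prod>i=1..r. inverse (2 ^ CARD('m) + 2 ^ i)) * (\<Sum>D | self_dual D \<and> C \<subseteq> D. cwe a (extend_code D) x))"
    by (simp only: mult.assoc)
  \<comment> \<open>Finiteness matters here: \<open>card\<close> of an infinite set is 0.\<close>
  moreover have "real (card ?G) \<noteq> 0"
    using finite_clifford subgroup.one_closed[OF subgroup_clifford] by (auto simp: card_gt_0_iff)
  ultimately show "1 / real (card ?G) * (\<Sum>g\<in>?G. act g (cwe a (extend_code C)) x) =
      (\<Prod>i=1..r. inverse (2 ^ CARD('m) + 2 ^ i)) * (\<Sum>C' | self_dual C' \<and> C \<subseteq> C'. cwe a (extend_code C') x)"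
    by (simp only: nonzero_mult_div_cancel_left times_divide_eq_left mult_1_left simp_thms)
qed

end
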